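(* Let $p \geq 1$ be a real number and let $E$ be a Banach lattice. The following are equivalent. (a) $E$ has the disjoint Dunford-Pettis property of order $p$ (disjoint $DPP_p$). (b) Every disjoint weakly $p$-summable sequence in $E$ is almost Dunford-Pettis. (c) For every disjoint weakly $p$-summable sequence $(x_n)_n$ in $E$ and every disjoint weakly null sequence $(x_n^\ast)_n$ in $E^\ast$, we have $x_n^\ast(x_n) \longrightarrow 0$. (d) For every disjoint weakly $p$-summable sequence $(x_n)_n$ in $E$ and every positive disjoint weakly null sequence $(x_n^\ast)_n$ in $E^\ast$, we have $x_n^\ast(x_n) \longrightarrow 0$. (e) For every disjoint weakly $p$-summable sequence $(x_n)_n$ in $E$ and every positive weakly null sequence $(x_n^\ast)_n$ in $E^\ast$, we have $x_n^\ast(x_n) \longrightarrow 0$.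
   Context: $E^\ast$ denotes the topological dual of $E$, a Banach lattice with its usual order. A sequence $(x_n)_n$ in a Banach lattice is disjoint if $|x_n| \wedge |x_m| = 0$ whenever $n \neq m$, and positive if $x_n \geq 0$ for every $n$. A sequence $(x_n)_n$ in a Banach space $X$ is weakly $p$-summable if $\sum_n |x^\ast(x_n)|^p < \infty$ for every $x^\ast \in X^\ast$. A subset $A$ of a Banach space $X$ is a Dunford-Pettis set if every weakly null sequence $(x_n^\ast)_n$ in $X^\ast$ converges uniformly to zero on $A$, i.e. $\sup_{x \in A}|x_n^\ast(x)| \to 0$. A bounded subset $A$ of a Banach lattice $E$ is almost Dunford-Pettis if every disjoint weakly null sequence in $E^\ast$ converges uniformly to zero on $A$. A sequence $(x_n)_n$ is said to have a property defined for sets if the set $\{x_n : n \in \mathbb{N}\}$ has the property. A Banach lattice $E$ has the disjoint Dunford-Pettis property of order $p$ (disjoint $DPP_p$) if every disjoint weakly $p$-summable sequence in $E$ is Dunford-Pettis. *)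

theory Defs
  imports "HOL-Analysis.Analysis" "HOL-Library.Lattice_Algebras"
begin

class banach_lattice = banach + lattice_ab_group_add_abs + ordered_real_vector +
  assumes norm_mono_abs: "\<bar>x\<bar> \<le> \<bar>y\<bar> \<Longrightarrow> norm x \<le> norm y"

instance real :: banach_lattice
  by intro_classes auto

type_synonym 'a dual = "'a \<Rightarrow>\<^sub>L real"


section \<open>The order of the dual\<close>

text \<open>
  The dual order is the one given by the positive cone of functionals that are nonnegative on
  positive vectors.  The lattice operations are the least upper and greatest lower bounds for this
  order; they exist by the Riesz--Kantorovich theorem, proved below.
\<close>

definition dual_le :: "'a::banach_lattice dual \<Rightarrow> 'a dual \<Rightarrow> bool" where
  "dual_le f g \<longleftrightarrow> (\<forall>x\<ge>0. blinfun_apply f x \<le> blinfun_apply g x)"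

definition dual_less :: "'a::banach_lattice dual \<Rightarrow> 'a dual \<Rightarrow> bool" where
  "dual_less f g \<longleftrightarrow> dual_le f g \<and> \<not> dual_le g f"

definition dual_sup :: "'a::banach_lattice dual \<Rightarrow> 'a dual \<Rightarrow> 'a dual" where
  "dual_sup f g = (THE h. dual_le f h \<and> dual_le g h \<and>
     (\<forall>k. dual_le f k \<and> dual_le g k \<longrightarrow> dual_le h k))"

definition dual_inf :: "'a::banach_lattice dual \<Rightarrow> 'a dual \<Rightarrow> 'a dual" where
  "dual_inf f g = (THE h. dual_le h f \<and> dual_le h g \<and>
     (\<forall>k. dual_le k f \<and> dual_le k g \<longrightarrow> dual_le k h))"

definition dual_abs :: "'a::banach_lattice dual \<Rightarrow> 'a dual" where
  "dual_abs f = dual_sup f (- f)"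

lemma pprt_minus_nprt:
  fixes x :: "'a::lattice_ab_group_add"
  shows "x = pprt x - (- nprt x)"
  using prts[of x] by simp

lemma norm_pprt_le:
  fixes x :: "'a::banach_lattice"
  shows "norm (pprt x) \<le> norm x" "norm (- nprt x) \<le> norm x"
proof -
  have a: "\<bar>x\<bar> = pprt x + (- nprt x)" using abs_prts[of x] by simp
  have "0 \<le> pprt x" "0 \<le> - nprt x" by simp_all
  then have "pprt x \<le> \<bar>x\<bar>" "- nprt x \<le> \<bar>x\<bar>" 
    unfolding a by (metis add.right_neutral add_left_mono, metis add.left_neutral add_right_mono)
  then show "norm (pprt x) \<le> norm x" "norm (- nprt x) \<le> norm x"
    by (intro norm_mono_abs; simp)+
qed

lemma dual_le_antisym:
  fixes f g :: "'a::banach_lattice dual"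
  assumes "dual_le f g" "dual_le g f"
  shows "f = g"
proof (rule blinfun_eqI)
  fix x
  have e: "blinfun_apply f y = blinfun_apply g y" if "y \<ge> 0" for y
    using assms that by (auto simp: dual_le_def intro: order.antisym)
  have "blinfun_apply f (pprt x - (- nprt x)) = blinfun_apply g (pprt x - (- nprt x))"
    using e[of "pprt x"] e[of "- nprt x"] by (simp only: blinfun.diff_right) simp
  then show "blinfun_apply f x = blinfun_apply g x"
    using pprt_minus_nprt[of x] by simp
qed

lemma riesz_kantorovich_pos_part:
  fixes f :: "'a::banach_lattice dual"
  obtains h where "dual_le f h" "dual_le 0 h" 
    "\<And>k. dual_le f k \<Longrightarrow> dual_le 0 k \<Longrightarrow> dual_le h k"
proof -
  define S where "S x = blinfun_apply f ` {y. 0 \<le> y \<and> y \<le> x}" for x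
  define p where "p x = Sup (S x)" for x
  define h where "h x = p (pprt x) - p (- nprt x)" for x
  have nb: "blinfun_apply f y \<le> norm f * norm x" if "0 \<le> y" "y \<le> x" for x y
  proof -
    have "norm y \<le> norm x" using that by (intro norm_mono_abs) (auto simp: abs_of_nonneg)
    then show ?thesis
      by (smt (verit) norm_blinfun[of f y] mult_left_mono norm_ge_zero real_norm_def)
  qed
  have bdd: "bdd_above (S x)" for x
    unfolding S_def by (rule bdd_aboveI2[where M = "norm f * norm x"]) (use nb in auto)
  have up: "blinfun_apply f y \<le> p x" if "0 \<le> y" "y \<le> x" for x y
    unfolding p_def by (rule cSup_upper[OF _ bdd]) (use that in \<open>auto simp: S_def\<close>)
  have least: "p x \<le> c" if "0 \<le> x" "\<And>y. 0 \<le> y \<Longrightarrow> y \<le> x \<Longrightarrow> blinfun_apply f y \<le> c" for x c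
    unfolding p_def by (rule cSup_least) (use that in \<open>auto simp: S_def\<close>)
  have p0: "0 \<le> p x" if "0 \<le> x" for x
    using up[of 0 x] that by simp
  have pn: "p x \<le> norm f * norm x" if "0 \<le> x" for x
    using least[OF that] nb by blast
  have padd: "p (u + v) = p u + p v" if "0 \<le> u" "0 \<le> v" for u v
  proof (rule order.antisym)
    show "p (u + v) \<le> p u + p v"
    proof (rule least)
      fix y assume y: "0 \<le> y" "y \<le> u + v"
      have d: "y - inf y u = sup 0 (y - u)"
        by (simp add: diff_inf_eq_sup add_sup_distrib_left)
      have "blinfun_apply f (inf y u) \<le> p u"
        by (rule up) (use y that in auto)
      moreover have "blinfun_apply f (y - inf y u) \<le> p v"
        by (rule up) (use y that d in \<open>auto simp: algebra_simps\<close>)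
      ultimately show "blinfun_apply f y \<le> p u + p v"
        by (simp add: blinfun.diff_right del: diff_inf_eq_sup)
    qed (use that in simp)
    have "p u \<le> p (u + v) - p v"
    proof (rule least[OF that(1)])
      fix a assume a: "0 \<le> a" "a \<le> u"
      have "p v \<le> p (u + v) - blinfun_apply f a"
      proof (rule least[OF that(2)])
        fix b assume b: "0 \<le> b" "b \<le> v"
        have "blinfun_apply f (a + b) \<le> p (u + v)"
          by (rule up) (use a b in \<open>auto intro: add_mono\<close>)
        then show "blinfun_apply f b \<le> p (u + v) - blinfun_apply f a"
          by (simp add: blinfun.add_right)
      qed
      then show "blinfun_apply f a \<le> p (u + v) - p v" by simp
    qed
    then show "p u + p v \<le> p (u + v)" by simp
  qed
  have pscale_le: "c * p u \<le> p (c *\<^sub>R u)" if "0 \<le> u" "0 < c" for u c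
  proof -
    have "p u \<le> p (c *\<^sub>R u) / c"
    proof (rule least[OF that(1)])
      fix y assume y: "0 \<le> y" "y \<le> u"
      have "blinfun_apply f (c *\<^sub>R y) \<le> p (c *\<^sub>R u)"
        by (rule up) (use y that in \<open>auto intro: scaleR_left_mono scaleR_nonneg_nonneg\<close>)
      then show "blinfun_apply f y \<le> p (c *\<^sub>R u) / c"
        using that by (simp add: blinfun.scaleR_right field_simps)
    qed
    then show ?thesis using that by (simp add: field_simps)
  qed
  have pscale: "p (c *\<^sub>R u) = c * p u" if "0 \<le> u" "0 < c" for u c
  proof (rule order.antisym)
    have "inverse c * p (c *\<^sub>R u) \<le> p (inverse c *\<^sub>R (c *\<^sub>R u))"
      by (rule pscale_le) (use that in \<open>auto intro: scaleR_nonneg_nonneg\<close>)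
    then show "p (c *\<^sub>R u) \<le> c * p u"
      using that by (simp add: field_simps)
  qed (use pscale_le that in blast)
  have hdiff: "h (a - b) = p a - p b" if "0 \<le> a" "0 \<le> b" for a b
  proof -
    have "pprt (a - b) + b = a + (- nprt (a - b))"
      using prts[of "a - b"] by (simp add: algebra_simps)
    then have "p (pprt (a - b) + b) = p (a + (- nprt (a - b)))" by simp
    then have "p (pprt (a - b)) + p b = p a + p (- nprt (a - b))"
      using that by (simp only: padd zero_le_pprt neg_0_le_iff_le nprt_le_zero)
    then show ?thesis by (simp add: h_def)
  qed
  have h_pos: "h x = p x" if "0 \<le> x" for x
    using hdiff[of x 0] padd[of 0 0] that by simp
  have h_add: "h (x + y) = h x + h y" for x y
  proof -
    have "x + y = (pprt x + pprt y) - (- nprt x + - nprt y)"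
      by (subst prts[of x], subst prts[of y])
        (simp only: diff_conv_add_uminus minus_add_distrib minus_minus ac_simps)
    then have "h (x + y) = p (pprt x + pprt y) - p (- nprt x + - nprt y)"
      by (metis hdiff add_nonneg_nonneg zero_le_pprt neg_0_le_iff_le nprt_le_zero)
    also have "\<dots> = h x + h y"
      unfolding h_def by (simp only: padd zero_le_pprt neg_0_le_iff_le nprt_le_zero)
    finally show ?thesis .
  qed
  have h_neg: "h (- x) = - h x" for x
    using h_add[of x "- x"] h_pos[of 0] padd[of 0 0] by simp
  have h_scale_pos: "h (c *\<^sub>R x) = c * h x" if "0 < c" for c x
  proof -
    have "c *\<^sub>R x = c *\<^sub>R pprt x - c *\<^sub>R (- nprt x)"
      by (subst scaleR_diff_right[symmetric]) (use prts[of x] in simp)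
    then have "h (c *\<^sub>R x) = p (c *\<^sub>R pprt x) - p (c *\<^sub>R (- nprt x))"
      using that
      by (metis hdiff less_imp_le scaleR_nonneg_nonneg zero_le_pprt neg_0_le_iff_le nprt_le_zero)
    also have "\<dots> = c * h x"
      using that unfolding h_def
      by (simp only: pscale zero_le_pprt neg_0_le_iff_le nprt_le_zero) (simp add: algebra_simps)
    finally show ?thesis .
  qed
  have h_scale: "h (c *\<^sub>R x) = c *\<^sub>R h x" for c x
  proof (cases c "0::real" rule: linorder_cases)
    case less
    then have "h ((- c) *\<^sub>R x) = (- c) * h x" by (intro h_scale_pos) simp
    then show ?thesis using h_neg[of "c *\<^sub>R x"] by simp
  next
    case equal
    then show ?thesis using h_pos[of 0] padd[of 0 0] by simp
  next
    case greater
    then show ?thesis using h_scale_pos by simp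
  qed
  have h_bound: "norm (h x) \<le> norm x * (2 * norm f)" for x
  proof -
    have "p (pprt x) \<le> norm f * norm x" "p (- nprt x) \<le> norm f * norm x"
      using pn[of "pprt x"] pn[of "- nprt x"] norm_pprt_le[of x]
      by (meson order_trans mult_left_mono norm_ge_zero zero_le_pprt neg_0_le_iff_le nprt_le_zero)+
    moreover have "0 \<le> p (pprt x)" "0 \<le> p (- nprt x)" by (intro p0; simp)+
    moreover have "0 \<le> norm f * norm x" by simp
    ultimately have "\<bar>p (pprt x) - p (- nprt x)\<bar> \<le> 2 * (norm f * norm x)" by linarith
    then show ?thesis by (simp add: h_def mult_ac)
  qed
  have bl: "bounded_linear h"
    by (rule bounded_linear_intro[OF h_add h_scale h_bound])
  have app: "blinfun_apply (Blinfun h) = h"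
    using bl by (rule bounded_linear_Blinfun_apply)
  show ?thesis
  proof (rule that[of "Blinfun h"])
    show "dual_le f (Blinfun h)"
      by (auto simp: dual_le_def app h_pos intro: up)
    show "dual_le 0 (Blinfun h)"
      by (auto simp: dual_le_def app h_pos intro: p0)
    fix k :: "'a dual" assume k: "dual_le f k" "dual_le 0 k"
    show "dual_le (Blinfun h) k"
      unfolding dual_le_def app
    proof (intro allI impI)
      fix x :: 'a assume x: "0 \<le> x"
      have "p x \<le> blinfun_apply k x"
      proof (rule least[OF x])
        fix y assume y: "0 \<le> y" "y \<le> x"
        have "blinfun_apply f y \<le> blinfun_apply k y" using k(1) y by (simp add: dual_le_def)
        moreover have "0 \<le> blinfun_apply k (x - y)" using k(2) y by (simp add: dual_le_def)
        ultimately show "blinfun_apply f y \<le> blinfun_apply k x"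
          by (simp add: blinfun.diff_right)
      qed
      then show "h x \<le> blinfun_apply k x" using x h_pos by simp
    qed
  qed
qed

lemma dual_sup_exists:
  fixes f g :: "'a::banach_lattice dual"
  shows "\<exists>h. dual_le f h \<and> dual_le g h \<and> (\<forall>k. dual_le f k \<and> dual_le g k \<longrightarrow> dual_le h k)"
proof -
  obtain h where h: "dual_le (f - g) h" "dual_le 0 h"
    "\<And>k. dual_le (f - g) k \<Longrightarrow> dual_le 0 k \<Longrightarrow> dual_le h k"
    by (rule riesz_kantorovich_pos_part[of "f - g"]) blast
  have "dual_le (h + g) k" if "dual_le f k" "dual_le g k" for k
    using h(3)[of "k - g"] that
    by (auto simp: dual_le_def blinfun.add_left blinfun.diff_left algebra_simps)
  moreover have "dual_le f (h + g)" "dual_le g (h + g)"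
    using h(1,2) by (auto simp: dual_le_def blinfun.add_left blinfun.diff_left algebra_simps)
  ultimately show ?thesis by blast
qed

lemma dual_inf_exists:
  fixes f g :: "'a::banach_lattice dual"
  shows "\<exists>h. dual_le h f \<and> dual_le h g \<and> (\<forall>k. dual_le k f \<and> dual_le k g \<longrightarrow> dual_le k h)"
proof -
  have neg: "dual_le (- a) b \<longleftrightarrow> dual_le (- b) a" "dual_le a (- b) \<longleftrightarrow> dual_le b (- a)"
    for a b :: "'a dual"
    by (auto simp: dual_le_def blinfun.minus_left minus_le_iff le_minus_iff)
  obtain h where "dual_le (- f) h" "dual_le (- g) h" 
    and least: "\<And>k. dual_le (- f) k \<Longrightarrow> dual_le (- g) k \<Longrightarrow> dual_le h k"
    using dual_sup_exists[of "- f" "- g"] by blast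
  then have "dual_le (- h) f" "dual_le (- h) g" by (simp_all add: neg)
  moreover have "dual_le k (- h)" if "dual_le k f" "dual_le k g" for k
    using least[of "- k"] that by (simp add: neg)
  ultimately show ?thesis by blast
qed

lemma dual_sup_lub:
  fixes f g :: "'a::banach_lattice dual"
  shows "dual_le f (dual_sup f g) \<and> dual_le g (dual_sup f g) \<and>
     (\<forall>k. dual_le f k \<and> dual_le g k \<longrightarrow> dual_le (dual_sup f g) k)"
  unfolding dual_sup_def
  by (rule theI', rule ex_ex1I[OF dual_sup_exists]) (blast intro: dual_le_antisym)

lemma dual_inf_glb:
  fixes f g :: "'a::banach_lattice dual"
  shows "dual_le (dual_inf f g) f \<and> dual_le (dual_inf f g) g \<and>
     (\<forall>k. dual_le k f \<and> dual_le k g \<longrightarrow> dual_le k (dual_inf f g))"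
  unfolding dual_inf_def
  by (rule theI', rule ex_ex1I[OF dual_inf_exists]) (blast intro: dual_le_antisym)

lemma dual_lattice_ab_group_add_abs:
  "class.lattice_ab_group_add_abs dual_abs (+) 0 (-) uminus
     dual_le dual_less dual_inf (dual_sup :: 'a::banach_lattice dual \<Rightarrow> _)"
proof unfold_locales
  fix a b c :: "'a dual"
  show "dual_less a b \<longleftrightarrow> dual_le a b \<and> \<not> dual_le b a" by (simp add: dual_less_def)
  show "dual_le a a" by (simp add: dual_le_def)
  show "dual_le a c" if "dual_le a b" "dual_le b c"
    using that by (fastforce simp: dual_le_def)
  show "a = b" if "dual_le a b" "dual_le b a" using that by (rule dual_le_antisym)
  show "dual_le (c + a) (c + b)" if "dual_le a b"
    using that by (simp add: dual_le_def blinfun.add_left)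
  show "dual_abs a = dual_sup a (- a)" by (simp add: dual_abs_def)
qed (use dual_inf_glb dual_sup_lub in blast)+


section \<open>Disjoint sequences, weak summability and Dunford-Pettis sets\<close>

definition disjoint_seq :: "(nat \<Rightarrow> 'a::banach_lattice) \<Rightarrow> bool" where
  "disjoint_seq x \<longleftrightarrow> (\<forall>n m. n \<noteq> m \<longrightarrow> inf \<bar>x n\<bar> \<bar>x m\<bar> = 0)"

definition dual_disjoint_seq :: "(nat \<Rightarrow> 'a::banach_lattice dual) \<Rightarrow> bool" where
  "dual_disjoint_seq f \<longleftrightarrow> (\<forall>n m. n \<noteq> m \<longrightarrow> dual_inf (dual_abs (f n)) (dual_abs (f m)) = 0)"

definition dual_positive_seq :: "(nat \<Rightarrow> 'a::banach_lattice dual) \<Rightarrow> bool" where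
  "dual_positive_seq f \<longleftrightarrow> (\<forall>n. dual_le 0 (f n))"

definition weakly_null :: "(nat \<Rightarrow> 'b::real_normed_vector) \<Rightarrow> bool" where
  "weakly_null x \<longleftrightarrow> (\<forall>\<phi> :: 'b dual. (\<lambda>n. blinfun_apply \<phi> (x n)) \<longlonglongrightarrow> 0)"

definition weakly_summable :: "real \<Rightarrow> (nat \<Rightarrow> 'b::real_normed_vector) \<Rightarrow> bool" where
  "weakly_summable p x \<longleftrightarrow> (\<forall>\<phi> :: 'b dual. summable (\<lambda>n. \<bar>blinfun_apply \<phi> (x n)\<bar> powr p))"

text \<open>
  A uniform limit rather than a supremum: \<open>Sup\<close> of an unbounded set of reals is unspecified.
\<close>

definition uniformly_null_on :: "'b::real_normed_vector set \<Rightarrow> (nat \<Rightarrow> 'b dual) \<Rightarrow> bool" where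
  "uniformly_null_on A f \<longleftrightarrow> uniform_limit A (\<lambda>n. blinfun_apply (f n)) (\<lambda>_. 0) sequentially"

definition dunford_pettis :: "'b::banach set \<Rightarrow> bool" where
  "dunford_pettis A \<longleftrightarrow> (\<forall>f. weakly_null f \<longrightarrow> uniformly_null_on A f)"

definition almost_dunford_pettis :: "'a::banach_lattice set \<Rightarrow> bool" where
  "almost_dunford_pettis A \<longleftrightarrow> bounded A \<and>
     (\<forall>f. dual_disjoint_seq f \<and> weakly_null f \<longrightarrow> uniformly_null_on A f)"

definition disjoint_DPP :: "real \<Rightarrow> 'a::banach_lattice itself \<Rightarrow> bool" where
  "disjoint_DPP p _ \<longleftrightarrow>
     (\<forall>x :: nat \<Rightarrow> 'a. disjoint_seq x \<and> weakly_summable p x \<longrightarrow> dunford_pettis (range x))"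

end

theory Submission
  imports Defs
begin

text \<open>
  If \<open>x\<^sub>k\<close> is disjoint and weakly \<open>p\<close>-summable and all its values are Dunford-Pettis, then a
  weakly null sequence \<open>f\<^sub>n\<close> tends to zero uniformly on \<open>{x\<^sub>k}\<close>, in particular along the diagonal.
  So (a) implies the other four conditions, up to the boundedness that is part of being almost
  Dunford-Pettis; and each of the others implies (d), the condition with the fewest test functionals.
  The substance is that (d) implies (a).

  Suppose \<open>f\<^sub>n\<close> is weakly null but not uniformly null on \<open>{x\<^sub>k}\<close>.  It is null at each single \<open>x\<^sub>k\<close>, so
  there are subsequences \<open>g\<^sub>j\<close> of \<open>f\<close> and \<open>y\<^sub>j\<close> of \<open>x\<close> with \<open>|g\<^sub>j(y\<^sub>j)| \<ge> \<epsilon>\<close>.  The \<open>g\<^sub>j\<close> are neither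
  positive nor disjoint, but the \<open>y\<^sub>j\<close> are disjoint: let \<open>u\<^sub>j\<close> be the part of \<open>g\<^sub>j\<^sup>+\<close> that lives on the
  ideal of \<open>|y\<^sub>j|\<close>, that is \<open>u\<^sub>j(x) = lim\<^sub>n g\<^sub>j\<^sup>+(x \<and> n|y\<^sub>j|)\<close> for \<open>x \<ge> 0\<close>.  The \<open>u\<^sub>j\<close> are positive and
  disjoint, and \<open>u\<^sub>j(y\<^sub>j) = g\<^sub>j\<^sup>+(y\<^sub>j)\<close>.  If they are weakly null, (d) gives \<open>g\<^sub>j\<^sup>+(y\<^sub>j) \<longlonglongrightarrow> 0\<close>; the same for
  \<open>- g\<^sub>j\<close> gives \<open>g\<^sub>j\<^sup>-(y\<^sub>j) \<longlonglongrightarrow> 0\<close>, and then \<open>g\<^sub>j(y\<^sub>j) \<longlonglongrightarrow> 0\<close>, a contradiction.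

  It remains to see that a disjoint sequence with \<open>0 \<le> u\<^sub>j \<le> g\<^sub>j\<^sup>+\<close> is weakly null when \<open>g\<^sub>j\<close> is, in any
  Banach lattice (\<open>weakly_null_disjoint_minorant\<close>).  The same construction, one dual higher up, does
  this.  For a positive functional \<open>\<phi>\<close> let \<open>\<theta>\<^sub>k\<close> be its part on the ideal of \<open>u\<^sub>k\<close>.  Disjointness gives
  \<open>\<Sum>\<^sub>k \<theta>\<^sub>k \<le> \<phi>\<close>, so each partial series \<open>\<Sum>\<^sub>k\<^sub>\<in>\<^sub>A \<theta>\<^sub>k\<close> is a bounded functional, and the matrix \<open>\<theta>\<^sub>k(g\<^sub>j)\<close> has
  absolutely summable rows whose sums over any set \<open>A\<close> of columns tend to zero.  A gliding hump
  argument (\<open>diagonal_tendsto_zero\<close>) forces the diagonal \<open>\<theta>\<^sub>k(g\<^sub>k)\<close> to tend to zero, and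
  \<open>0 \<le> \<phi>(u\<^sub>k) \<le> \<theta>\<^sub>k(g\<^sub>k)\<close> because \<open>\<theta>\<^sub>k\<close> vanishes on \<open>g\<^sub>k\<^sup>-\<close>.

  Boundedness of weakly \<open>p\<close>-summable sequences is the uniform boundedness principle in the dual; it
  needs norming functionals, hence the Hahn-Banach theorem.
\<close>


section \<open>Functionals determined by their values on the positive cone\<close>

lemma additive_scaleR_nat:
  fixes h :: "'a::real_vector \<Rightarrow> real"
  assumes "\<And>x y. h (x + y) = h x + h y"
  shows "h (real n *\<^sub>R x) = real n * h x"
proof (induction n)
  case 0
  have "h (0 + 0) = h 0 + h 0" by (rule assms)
  then show ?case by simp
next
  case (Suc n)
  have "h (real (Suc n) *\<^sub>R x) = h (x + real n *\<^sub>R x)" by (simp add: scaleR_add_left)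
  then show ?case using Suc by (simp add: assms algebra_simps)
qed

text \<open>
  Homogeneity comes for free: for \<open>c \<ge> 0\<close> the defect \<open>d = h (c x) - c h x\<close> satisfies \<open>n d = h (e x) - e h x\<close>,
  where \<open>e\<close> is the fractional part of \<open>n c\<close>, so its multiples stay bounded and \<open>d = 0\<close>.
\<close>

lemma bounded_additive_imp_bounded_linear:
  fixes h :: "'a::real_normed_vector \<Rightarrow> real"
  assumes add: "\<And>x y. h (x + y) = h x + h y" and bound: "\<And>x. \<bar>h x\<bar> \<le> norm x * K"
  shows "bounded_linear h"
proof -
  have nat: "h (real n *\<^sub>R x) = real n * h x" for n x
    by (rule additive_scaleR_nat[OF add])
  have neg: "h (- x) = - h x" for x
    using add[of x "- x"] nat[of 0 x] by simp
  have pos: "h (c *\<^sub>R x) = c * h x" if "c \<ge> 0" for c x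
  proof -
    define d where "d = h (c *\<^sub>R x) - c * h x"
    have small: "real n * \<bar>d\<bar> \<le> 2 * (norm x * \<bar>K\<bar>)" for n
    proof -
      define m where "m = nat \<lfloor>real n * c\<rfloor>"
      define e where "e = real n * c - real m"
      have "real m = of_int \<lfloor>real n * c\<rfloor>" using that by (simp add: m_def)
      then have e: "0 \<le> e" "e \<le> 1" unfolding e_def by linarith+
      have nc: "real n * c = real m + e" by (simp add: e_def)
      have "real n * h (c *\<^sub>R x) = h ((real m + e) *\<^sub>R x)"
        unfolding nat[symmetric] nc[symmetric] by simp
      then have nh: "real n * h (c *\<^sub>R x) = real m * h x + h (e *\<^sub>R x)"
        by (simp only: scaleR_add_left add nat)
      have "real n * d = real n * h (c *\<^sub>R x) - (real n * c) * h x"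
        by (simp add: d_def algebra_simps)
      then have eq: "real n * d = h (e *\<^sub>R x) - e * h x"
        unfolding nh nc by (simp add: algebra_simps)
      have K: "norm x * K \<le> norm x * \<bar>K\<bar>" by (intro mult_left_mono) auto
      have "\<bar>h (e *\<^sub>R x)\<bar> \<le> norm (e *\<^sub>R x) * \<bar>K\<bar>"
        using bound[of "e *\<^sub>R x"] mult_left_mono[OF abs_ge_self[of K] norm_ge_zero[of "e *\<^sub>R x"]] by linarith
      also have "\<dots> \<le> norm x * \<bar>K\<bar>"
        using e by (auto intro!: mult_right_mono mult_left_le_one_le)
      finally have 1: "\<bar>h (e *\<^sub>R x)\<bar> \<le> norm x * \<bar>K\<bar>" .
      have "\<bar>e * h x\<bar> \<le> \<bar>h x\<bar>" using e by (simp add: abs_mult mult_left_le_one_le)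
      with 1 K bound[of x] eq have "\<bar>real n * d\<bar> \<le> 2 * (norm x * \<bar>K\<bar>)" by linarith
      then show ?thesis by (simp add: abs_mult)
    qed
    have "d = 0"
    proof (rule ccontr)
      assume "d \<noteq> 0"
      then obtain n where "2 * (norm x * \<bar>K\<bar>) < real n * \<bar>d\<bar>"
        using reals_Archimedean3[of "\<bar>d\<bar>"] by auto
      with small[of n] show False by simp
    qed
    then show ?thesis by (simp add: d_def)
  qed
  have "h (c *\<^sub>R x) = c *\<^sub>R h x" for c x
    using pos[of c x] pos[of "- c" x] neg[of "c *\<^sub>R x"] by (cases "c \<ge> 0") auto
  then show ?thesis by (intro bounded_linear_intro[OF add _ _]) (use bound in auto)
qed

lemma norm_abs_lattice [simp]:
  fixes x :: "'a::banach_lattice"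
  shows "norm \<bar>x\<bar> = norm x"
  by (intro order.antisym norm_mono_abs) simp_all

lemma norm_mono_nonneg:
  fixes x :: "'a::banach_lattice"
  assumes "0 \<le> x" "x \<le> y"
  shows "norm x \<le> norm y"
  using assms by (intro norm_mono_abs) (auto simp: abs_of_nonneg)

lemma positive_functional_mono:
  fixes \<phi> :: "'a::banach_lattice dual"
  assumes "dual_le 0 \<phi>" "x \<le> y"
  shows "blinfun_apply \<phi> x \<le> blinfun_apply \<phi> y"
proof -
  have "0 \<le> blinfun_apply \<phi> (y - x)" using assms by (simp add: dual_le_def)
  then show ?thesis by (simp add: blinfun.diff_right)
qed

lemma positive_functional_abs_le:
  fixes \<phi> :: "'a::banach_lattice dual"
  assumes "dual_le 0 \<phi>"
  shows "\<bar>blinfun_apply \<phi> x\<bar> \<le> blinfun_apply \<phi> \<bar>x\<bar>"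
  using positive_functional_mono[OF assms abs_ge_self[of x]]
    positive_functional_mono[OF assms abs_ge_minus_self[of x]]
  by (intro abs_leI) (simp_all only: blinfun.minus_right)

text \<open>
  The extension is \<open>h x = p (x\<^sup>+) - p (x\<^sup>-)\<close>; by additivity any other way of writing \<open>x\<close> as a difference of
  positive vectors gives the same value, which makes \<open>h\<close> additive.
\<close>

lemma cone_functional_extension:
  fixes p :: "'a::banach_lattice \<Rightarrow> real"
  assumes add: "\<And>x y. 0 \<le> x \<Longrightarrow> 0 \<le> y \<Longrightarrow> p (x + y) = p x + p y"
    and nonneg: "\<And>x. 0 \<le> x \<Longrightarrow> 0 \<le> p x"
    and bound: "\<And>x. 0 \<le> x \<Longrightarrow> p x \<le> norm x * K"
  obtains h :: "'a dual" where "\<And>x. 0 \<le> x \<Longrightarrow> blinfun_apply h x = p x"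
proof -
  define h where "h x = p (pprt x) - p (- nprt x)" for x
  have neg_nprt: "0 \<le> - nprt x" for x :: 'a by simp
  have hdiff: "h (a - b) = p a - p b" if "0 \<le> a" "0 \<le> b" for a b
  proof -
    have "pprt (a - b) + b = a + (- nprt (a - b))"
      using prts[of "a - b"] by (simp add: algebra_simps)
    then have "p (pprt (a - b)) + p b = p a + p (- nprt (a - b))"
      using that neg_nprt[of "a - b"] add by (metis zero_le_pprt)
    then show ?thesis by (simp add: h_def)
  qed
  have p0: "p 0 = 0" using add[of 0 0] by simp
  have h_add: "h (x + y) = h x + h y" for x y
  proof -
    have "x + y = (pprt x + pprt y) - (- nprt x + - nprt y)"
      by (subst prts[of x], subst prts[of y])
        (simp only: diff_conv_add_uminus minus_add_distrib minus_minus ac_simps)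
    then have "h (x + y) = p (pprt x + pprt y) - p (- nprt x + - nprt y)"
      using hdiff neg_nprt by (metis add_nonneg_nonneg zero_le_pprt)
    also have "\<dots> = h x + h y"
      unfolding h_def using add neg_nprt zero_le_pprt by (smt (verit))
    finally show ?thesis .
  qed
  have "\<bar>h x\<bar> \<le> norm x * K" for x
  proof -
    have "\<bar>x\<bar> = pprt x + - nprt x" using abs_prts[of x] by simp
    then have "p \<bar>x\<bar> = p (pprt x) + p (- nprt x)" using add neg_nprt by (metis zero_le_pprt)
    moreover have "p \<bar>x\<bar> \<le> norm x * K" using bound[of "\<bar>x\<bar>"] by simp
    ultimately show ?thesis
      using nonneg[OF zero_le_pprt[of x]] nonneg[OF neg_nprt[of x]] by (simp add: h_def)
  qed
  then have "bounded_linear h" by (rule bounded_additive_imp_bounded_linear[OF h_add])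
  then have app: "blinfun_apply (Blinfun h) = h" by (rule bounded_linear_Blinfun_apply)
  show ?thesis
    by (rule that[of "Blinfun h"]) (use hdiff[of _ 0] p0 in \<open>simp add: app\<close>)
qed

text \<open>
  The positive part of \<open>f\<close> is given on the cone by \<open>x \<mapsto> sup {f y | 0 \<le> y \<le> x}\<close>.  The last conclusion
  records the bound by this supremum, which is stronger than minimality among the positive majorants of
  \<open>f\<close>; it is what makes the norm of the modulus computable.
\<close>

lemma positive_part_functional:
  fixes f :: "'a::banach_lattice dual"
  obtains h :: "'a dual" where "dual_le f h" "dual_le 0 h"
    "\<And>x c. 0 \<le> x \<Longrightarrow> (\<And>y. 0 \<le> y \<Longrightarrow> y \<le> x \<Longrightarrow> blinfun_apply f y \<le> c) \<Longrightarrow> blinfun_apply h x \<le> c"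
proof -
  define S where "S x = blinfun_apply f ` {0..x}" for x
  define p where "p x = Sup (S x)" for x
  have nb: "blinfun_apply f y \<le> norm x * norm f" if "0 \<le> y" "y \<le> x" for x y
  proof -
    have "blinfun_apply f y \<le> norm f * norm y" using norm_blinfun[of f y] by simp
    also have "\<dots> \<le> norm f * norm x" using norm_mono_nonneg[OF that] by (intro mult_left_mono) auto
    finally show ?thesis by (simp add: mult.commute)
  qed
  have bdd: "bdd_above (S x)" for x
    unfolding S_def by (rule bdd_aboveI2[where M = "norm x * norm f"]) (use nb in auto)
  have up: "blinfun_apply f y \<le> p x" if "0 \<le> y" "y \<le> x" for x y
    unfolding p_def by (rule cSup_upper[OF _ bdd]) (use that in \<open>auto simp: S_def\<close>)
  have least: "p x \<le> c" if "0 \<le> x" "\<And>y. 0 \<le> y \<Longrightarrow> y \<le> x \<Longrightarrow> blinfun_apply f y \<le> c" for x c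
    unfolding p_def by (rule cSup_least) (use that in \<open>auto simp: S_def\<close>)
  have p0: "0 \<le> p x" if "0 \<le> x" for x
    using up[of 0 x] that by simp
  have padd: "p (u + v) = p u + p v" if "0 \<le> u" "0 \<le> v" for u v
  proof (rule order.antisym)
    \<comment> \<open>Riesz decomposition: \<open>y\<close> splits as \<open>y \<and> u\<close>, below \<open>u\<close>, and \<open>y - y \<and> u\<close>, below \<open>v\<close>.\<close>
    show "p (u + v) \<le> p u + p v"
    proof (rule least)
      fix y assume y: "0 \<le> y" "y \<le> u + v"
      have d: "y - inf y u = sup 0 (y - u)"
        by (simp add: diff_inf_eq_sup add_sup_distrib_left)
      have "blinfun_apply f (inf y u) \<le> p u"
        by (rule up) (use y that in auto)
      moreover have "blinfun_apply f (y - inf y u) \<le> p v"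
        by (rule up) (use y that d in \<open>auto simp: algebra_simps\<close>)
      ultimately show "blinfun_apply f y \<le> p u + p v"
        by (simp add: blinfun.diff_right del: diff_inf_eq_sup)
    qed (use that in simp)
    have "p u \<le> p (u + v) - p v"
    proof (rule least[OF that(1)])
      fix a assume a: "0 \<le> a" "a \<le> u"
      have "p v \<le> p (u + v) - blinfun_apply f a"
      proof (rule least[OF that(2)])
        fix b assume b: "0 \<le> b" "b \<le> v"
        have "blinfun_apply f (a + b) \<le> p (u + v)"
          by (rule up) (use a b in \<open>auto intro: add_mono\<close>)
        then show "blinfun_apply f b \<le> p (u + v) - blinfun_apply f a"
          by (simp add: blinfun.add_right)
      qed
      then show "blinfun_apply f a \<le> p (u + v) - p v" by simp
    qed
    then show "p u + p v \<le> p (u + v)" by simp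
  qed
  have pn: "p x \<le> norm x * norm f" if "0 \<le> x" for x
    using least[OF that] nb by blast
  obtain h :: "'a dual" where h: "\<And>x. 0 \<le> x \<Longrightarrow> blinfun_apply h x = p x"
    using cone_functional_extension[OF padd p0 pn] by blast
  show ?thesis
    by (rule that[of h]) (use up p0 least in \<open>auto simp: dual_le_def h\<close>)
qed


section \<open>Disjoint positive elements of a Riesz space\<close>

lemma inf_add_le:
  fixes x :: "'a::lattice_ab_group_add"
  assumes "0 \<le> x" "0 \<le> a" "0 \<le> b"
  shows "inf x (a + b) \<le> inf x a + inf x b"
proof -
  have "inf x (a + b) \<le> inf (a + x) (a + b)"
    using assms by (intro inf_mono add_increasing order_refl)
  moreover have "inf x (a + b) \<le> inf (x + x) (x + b)"
    using assms by (intro le_infI le_infI1 add_increasing2 order_refl)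
  ultimately have "inf x (a + b) \<le> inf (a + inf x b) (x + inf x b)"
    by (simp only: add_inf_distrib_left le_inf_iff)
  then show ?thesis by (simp only: add_inf_distrib_right[symmetric] inf_commute)
qed

lemma inf_add_le_left:
  fixes x :: "'a::lattice_ab_group_add"
  assumes "0 \<le> x" "0 \<le> a" "0 \<le> b"
  shows "inf (a + b) x \<le> inf a x + inf b x"
  using inf_add_le[OF assms] by (simp add: inf_commute)

lemma inf_pprt_minus_nprt:
  fixes x :: "'a::lattice_ab_group_add"
  shows "inf (pprt x) (- nprt x) = 0"
proof -
  have "- nprt x = pprt x + - x" by (subst (2) prts) (simp add: algebra_simps)
  then have "inf (pprt x) (- nprt x) = pprt x + inf 0 (- x)"
    by (simp only: add_inf_distrib_left add_0_right)
  also have "inf 0 (- x) = - pprt x" by (simp add: pprt_def neg_sup_eq_inf inf_commute)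
  finally show ?thesis by simp
qed

lemma inf_scaleR_nat_eq_0:
  fixes x y :: "'a::banach_lattice"
  assumes "0 \<le> x" "0 \<le> y" "inf x y = 0"
  shows "inf x (real n *\<^sub>R y) = 0"
proof (induction n)
  case 0
  then show ?case using assms by (simp add: inf_absorb2)
next
  case (Suc n)
  have "inf x (real n *\<^sub>R y + y) \<le> inf x (real n *\<^sub>R y) + inf x y"
    by (rule inf_add_le) (use assms in \<open>auto intro: scaleR_nonneg_nonneg\<close>)
  then have "inf x (real (Suc n) *\<^sub>R y) \<le> 0" using Suc assms by (simp add: algebra_simps)
  moreover have "0 \<le> inf x (real (Suc n) *\<^sub>R y)" 
    using assms by (auto intro: scaleR_nonneg_nonneg simp del: of_nat_Suc)
  ultimately show ?case by (rule order.antisym)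
qed

lemma inf_scaleR_nat_disjoint:
  fixes x y z :: "'a::banach_lattice"
  assumes "0 \<le> x" "0 \<le> y" "0 \<le> z" "inf y z = 0"
  shows "inf (inf x (real n *\<^sub>R y)) z = 0"
proof (rule order.antisym)
  have "inf (inf x (real n *\<^sub>R y)) z \<le> inf z (real n *\<^sub>R y)" by (simp add: le_infI1 le_infI2)
  also have "\<dots> = 0" by (rule inf_scaleR_nat_eq_0) (use assms in \<open>auto simp: inf_commute\<close>)
  finally show "inf (inf x (real n *\<^sub>R y)) z \<le> 0" .
qed (use assms in \<open>simp add: scaleR_nonneg_nonneg\<close>)

lemma inf_sum_eq_0:
  fixes x :: "'a::lattice_ab_group_add"
  assumes "finite A" "0 \<le> x" "\<And>i. i \<in> A \<Longrightarrow> 0 \<le> a i" "\<And>i. i \<in> A \<Longrightarrow> inf x (a i) = 0"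
  shows "inf x (sum a A) = 0"
  using assms
proof (induction A)
  case empty
  then show ?case by (simp add: inf_absorb2)
next
  case (insert k A)
  have "inf x (a k + sum a A) \<le> inf x (a k) + inf x (sum a A)"
    by (rule inf_add_le) (use insert.prems in \<open>auto intro: sum_nonneg\<close>)
  then have "inf x (sum a (insert k A)) \<le> 0" using insert by simp
  moreover have "0 \<le> inf x (sum a (insert k A))"
    using insert.prems by (intro le_infI sum_nonneg) auto
  ultimately show ?case by (rule order.antisym)
qed

text \<open>
  Disjoint positive elements add up to their supremum, since \<open>a + b = a \<or> b + a \<and> b\<close>.
\<close>

lemma sum_disjoint_le:
  fixes z :: "'a::lattice_ab_group_add"
  assumes "finite A" "0 \<le> z" "\<And>i. i \<in> A \<Longrightarrow> 0 \<le> a i" "\<And>i. i \<in> A \<Longrightarrow> a i \<le> z"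
    "\<And>i j. i \<in> A \<Longrightarrow> j \<in> A \<Longrightarrow> i \<noteq> j \<Longrightarrow> inf (a i) (a j) = 0"
  shows "sum a A \<le> z"
  using assms
proof (induction A)
  case (insert k A)
  have "inf (a k) (sum a A) = 0"
    by (rule inf_sum_eq_0) (use insert in auto)
  then have "sum a (insert k A) = sup (a k) (sum a A)"
    using insert.hyps add_eq_inf_sup[of "a k" "sum a A"] by simp
  also have "\<dots> \<le> z" using insert by (intro le_supI) auto
  finally show ?case .
qed simp


section \<open>The component of a positive functional on a principal ideal\<close>

text \<open>
  The limit is additive in \<open>x\<close> because
  \<open>(u + v) \<and> n y \<le> u \<and> n y + v \<and> n y \<le> (u + v) \<and> 2 n y\<close> for positive \<open>u\<close> and \<open>v\<close>.
\<close>

lemma ideal_component_exists: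
  fixes \<phi> :: "'a::banach_lattice dual"
  assumes \<phi>: "dual_le 0 \<phi>" and y: "0 \<le> y"
  shows "\<exists>\<theta> :: 'a dual. \<forall>x\<ge>0.
    (\<lambda>n. blinfun_apply \<phi> (inf x (real n *\<^sub>R y))) \<longlonglongrightarrow> blinfun_apply \<theta> x"
proof -
  define t where "t x n = blinfun_apply \<phi> (inf x (real n *\<^sub>R y))" for x n
  define p where "p x = lim (t x)" for x
  have ny: "0 \<le> real n *\<^sub>R y" for n using y by (simp add: scaleR_nonneg_nonneg)
  have t_nonneg: "0 \<le> t x n" if "0 \<le> x" for x n
    using positive_functional_mono[OF \<phi>, of 0 "inf x (real n *\<^sub>R y)"] that ny by (simp add: t_def)
  have t_le: "t x n \<le> blinfun_apply \<phi> x" for x n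
    unfolding t_def by (rule positive_functional_mono[OF \<phi>]) simp
  have t_inc: "incseq (t x)" for x
  proof (rule incseq_SucI)
    fix n
    have "inf x (real n *\<^sub>R y) \<le> inf x (real (Suc n) *\<^sub>R y)"
      by (intro inf_mono order_refl scaleR_right_mono) (use y in auto)
    then show "t x n \<le> t x (Suc n)" unfolding t_def by (rule positive_functional_mono[OF \<phi>])
  qed
  have lim: "t x \<longlonglongrightarrow> p x" for x
  proof -
    obtain L where "t x \<longlonglongrightarrow> L"
      by (rule incseq_convergent[OF t_inc[of x], of "blinfun_apply \<phi> x"]) (use t_le in auto)
    then show ?thesis unfolding p_def by (simp add: limI)
  qed
  have padd: "p (u + v) = p u + p v" if "0 \<le> u" "0 \<le> v" for u v
  proof (rule order.antisym)
    have lim_sum: "(\<lambda>n. t u n + t v n) \<longlonglongrightarrow> p u + p v" by (intro tendsto_add lim)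
    show "p (u + v) \<le> p u + p v"
    proof (rule LIMSEQ_le[OF lim lim_sum], intro exI allI impI)
      fix n
      have "inf (u + v) (real n *\<^sub>R y) \<le> inf u (real n *\<^sub>R y) + inf v (real n *\<^sub>R y)"
        by (rule inf_add_le_left) (use that ny in auto)
      from positive_functional_mono[OF \<phi> this] show "t (u + v) n \<le> t u n + t v n"
        by (simp add: t_def blinfun.add_right)
    qed
    have lim2: "(\<lambda>n. t (u + v) (2 * n)) \<longlonglongrightarrow> p (u + v)"
      by (rule LIMSEQ_subseq_LIMSEQ[OF lim, of "\<lambda>n. 2 * n", unfolded o_def])
        (simp add: strict_mono_def)
    show "p u + p v \<le> p (u + v)"
    proof (rule LIMSEQ_le[OF lim_sum lim2], intro exI allI impI)
      fix n
      have "inf u (real n *\<^sub>R y) + inf v (real n *\<^sub>R y) \<le> inf (u + v) (real n *\<^sub>R y + real n *\<^sub>R y)"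
        by (intro le_infI add_mono) auto
      also have "real n *\<^sub>R y + real n *\<^sub>R y = real (2 * n) *\<^sub>R y"
        by (simp flip: scaleR_add_left)
      finally show "t u n + t v n \<le> t (u + v) (2 * n)"
        unfolding t_def blinfun.add_right[symmetric] by (rule positive_functional_mono[OF \<phi>])
    qed
  qed
  have p_nonneg: "0 \<le> p x" if "0 \<le> x" for x
    by (rule LIMSEQ_le_const[OF lim]) (use t_nonneg that in auto)
  have p_bound: "p x \<le> norm x * norm \<phi>" if "0 \<le> x" for x
  proof -
    have "p x \<le> blinfun_apply \<phi> x" by (rule LIMSEQ_le_const2[OF lim]) (use t_le in auto)
    also have "\<dots> \<le> norm x * norm \<phi>" using norm_blinfun[of \<phi> x] by (simp add: mult.commute)
    finally show ?thesis .
  qed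
  obtain \<theta> :: "'a dual" where "\<And>x. 0 \<le> x \<Longrightarrow> blinfun_apply \<theta> x = p x"
    using cone_functional_extension[OF padd p_nonneg p_bound] by blast
  then show ?thesis using lim by (intro exI[of _ \<theta>]) (simp add: t_def[abs_def])
qed

text \<open>
  The part of \<open>\<phi>\<close> carried by the ideal that \<open>y\<close> generates: it keeps \<open>\<phi>\<close> on that ideal and vanishes on
  the elements disjoint from \<open>y\<close>.  The limit exists when \<open>\<phi>\<close> and \<open>y\<close> are positive.
\<close>

definition ideal_component :: "'a::banach_lattice dual \<Rightarrow> 'a \<Rightarrow> 'a dual" where
  "ideal_component \<phi> y = (SOME \<theta>. \<forall>x\<ge>0.
     (\<lambda>n. blinfun_apply \<phi> (inf x (real n *\<^sub>R y))) \<longlonglongrightarrow> blinfun_apply \<theta> x)"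

context
  fixes \<phi> :: "'a::banach_lattice dual" and y :: 'a
  assumes \<phi>: "dual_le 0 \<phi>" and y: "0 \<le> y"
begin

lemma ideal_component_tendsto:
  assumes "0 \<le> x"
  shows "(\<lambda>n. blinfun_apply \<phi> (inf x (real n *\<^sub>R y))) \<longlonglongrightarrow> blinfun_apply (ideal_component \<phi> y) x"
  using someI_ex[OF ideal_component_exists[OF \<phi> y]] assms unfolding ideal_component_def by blast

lemma ideal_component_upper:
  assumes "0 \<le> x"
  shows "blinfun_apply \<phi> (inf x (real n *\<^sub>R y)) \<le> blinfun_apply (ideal_component \<phi> y) x"
proof -
  have "incseq (\<lambda>n. blinfun_apply \<phi> (inf x (real n *\<^sub>R y)))"
    by (intro incseq_SucI positive_functional_mono[OF \<phi>] inf_mono order_refl scaleR_right_mono)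
      (use y in auto)
  then show ?thesis by (rule incseq_le[OF _ ideal_component_tendsto[OF assms]])
qed

lemma ideal_component_nonneg: "dual_le 0 (ideal_component \<phi> y)"
  unfolding dual_le_def
proof (intro allI impI)
  fix x :: 'a assume "0 \<le> x"
  then have "inf x (real 0 *\<^sub>R y) = 0" by (simp add: inf_absorb2)
  with ideal_component_upper[OF \<open>0 \<le> x\<close>, of 0]
  show "blinfun_apply 0 x \<le> blinfun_apply (ideal_component \<phi> y) x" by simp
qed

lemma ideal_component_le: "dual_le (ideal_component \<phi> y) \<phi>"
  unfolding dual_le_def
  by (intro allI impI LIMSEQ_le_const2[OF ideal_component_tendsto] exI positive_functional_mono[OF \<phi>])
    simp_all

lemma ideal_component_eq:
  assumes "0 \<le> x" "x \<le> y"
  shows "blinfun_apply (ideal_component \<phi> y) x = blinfun_apply \<phi> x"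
proof (rule order.antisym)
  show "blinfun_apply (ideal_component \<phi> y) x \<le> blinfun_apply \<phi> x"
    using ideal_component_le assms by (simp add: dual_le_def)
  have "inf x (real 1 *\<^sub>R y) = x" using assms by (simp add: inf_absorb1)
  with ideal_component_upper[OF assms(1), of 1]
  show "blinfun_apply \<phi> x \<le> blinfun_apply (ideal_component \<phi> y) x" by simp
qed

lemma ideal_component_disjoint:
  assumes "0 \<le> x" "inf x y = 0"
  shows "blinfun_apply (ideal_component \<phi> y) x = 0"
proof -
  have "(\<lambda>n. blinfun_apply \<phi> (inf x (real n *\<^sub>R y))) = (\<lambda>n. 0)"
    using inf_scaleR_nat_eq_0[OF assms(1) y assms(2)] by simp
  with ideal_component_tendsto[OF assms(1)] show ?thesis
    by (simp add: LIMSEQ_const_iff)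
qed

end

lemma ideal_component_abs_apply:
  fixes \<phi> :: "'a::banach_lattice dual"
  assumes "dual_le 0 \<phi>"
  shows "blinfun_apply (ideal_component \<phi> \<bar>y\<bar>) y = blinfun_apply \<phi> y"
proof -
  have nn: "0 \<le> - nprt y" by simp
  have "pprt y \<le> \<bar>y\<bar>" "- nprt y \<le> \<bar>y\<bar>"
    using abs_prts[of y] zero_le_pprt[of y] nn by (metis add_increasing2 order_refl diff_conv_add_uminus,
      metis add_increasing order_refl diff_conv_add_uminus)
  then have "blinfun_apply (ideal_component \<phi> \<bar>y\<bar>) (pprt y - (- nprt y)) = blinfun_apply \<phi> (pprt y - (- nprt y))"
    unfolding blinfun.diff_right
    using ideal_component_eq[OF assms abs_ge_zero] nn zero_le_pprt by (metis (no_types))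
  then show ?thesis by (simp add: pprt_minus_nprt[symmetric] flip: prts)
qed

text \<open>
  A common minorant \<open>m \<ge> 0\<close> of both components is small on each half of the splitting
  \<open>x = a\<^sub>n + (x - a\<^sub>n)\<close> with \<open>a\<^sub>n = x \<and> n y\<close>: the first half is disjoint from \<open>z\<close>, so the component of \<open>\<psi>\<close>
  vanishes there, and on the second half the component of \<open>\<phi>\<close> tends to zero.
\<close>

lemma dual_inf_ideal_component_eq_0:
  fixes \<phi> \<psi> :: "'a::banach_lattice dual"
  assumes "dual_le 0 \<phi>" "dual_le 0 \<psi>" "0 \<le> y" "0 \<le> z" "inf y z = 0"
  shows "dual_inf (ideal_component \<phi> y) (ideal_component \<psi> z) = 0"
proof -
  define m where "m = dual_inf (ideal_component \<phi> y) (ideal_component \<psi> z)"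
  have le: "dual_le m (ideal_component \<phi> y)" "dual_le m (ideal_component \<psi> z)"
    and m0: "dual_le 0 m"
    unfolding m_def using dual_inf_glb ideal_component_nonneg assms by blast+
  have "blinfun_apply m x \<le> 0" if x: "0 \<le> x" for x
  proof -
    define a where "a n = inf x (real n *\<^sub>R y)" for n
    have a: "0 \<le> a n" "a n \<le> x" for n
      using x assms(3) by (auto simp: a_def scaleR_nonneg_nonneg)
    have "blinfun_apply m x \<le> blinfun_apply (ideal_component \<phi> y) x - blinfun_apply \<phi> (a n)" for n
    proof -
      have "blinfun_apply m (a n) \<le> blinfun_apply (ideal_component \<psi> z) (a n)"
        using le(2) a by (simp add: dual_le_def)
      also have "\<dots> = 0"
        using inf_scaleR_nat_disjoint[OF x assms(3,4,5)]
        by (intro ideal_component_disjoint) (use assms a in \<open>auto simp: a_def\<close>)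
      finally have 1: "blinfun_apply m (a n) \<le> 0" .
      have "blinfun_apply m (x - a n) \<le> blinfun_apply (ideal_component \<phi> y) (x - a n)"
        using le(1) a by (simp add: dual_le_def)
      moreover have "blinfun_apply \<phi> (a n) \<le> blinfun_apply (ideal_component \<phi> y) (a n)"
        using ideal_component_upper[OF assms(1,3) a(1), of n n] by (simp add: a_def)
      ultimately show ?thesis using 1 by (simp add: blinfun.diff_right)
    qed
    moreover have "(\<lambda>n. blinfun_apply (ideal_component \<phi> y) x - blinfun_apply \<phi> (a n)) \<longlonglongrightarrow> 
        blinfun_apply (ideal_component \<phi> y) x - blinfun_apply (ideal_component \<phi> y) x"
      unfolding a_def by (intro tendsto_intros ideal_component_tendsto assms x)
    ultimately show ?thesis by (intro LIMSEQ_le_const) auto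
  qed
  then have "dual_le m 0" by (simp add: dual_le_def)
  with m0 show ?thesis unfolding m_def[symmetric] by (rule dual_le_antisym[rotated])
qed

text \<open>
  For each \<open>n\<close> the elements \<open>x \<and> n u\<^sub>k\<close> are disjoint and below \<open>x\<close>, so that their sum is below \<open>x\<close> too.
\<close>

lemma sum_ideal_components_le:
  fixes \<phi> :: "'a::banach_lattice dual" and u :: "nat \<Rightarrow> 'a"
  assumes \<phi>: "dual_le 0 \<phi>" and u: "\<And>k. 0 \<le> u k" "\<And>j k. j \<noteq> k \<Longrightarrow> inf (u j) (u k) = 0"
    and "finite A" and x: "0 \<le> x"
  shows "(\<Sum>k\<in>A. blinfun_apply (ideal_component \<phi> (u k)) x) \<le> blinfun_apply \<phi> x"
proof (rule LIMSEQ_le_const2)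
  show "(\<lambda>n. \<Sum>k\<in>A. blinfun_apply \<phi> (inf x (real n *\<^sub>R u k))) \<longlonglongrightarrow>
      (\<Sum>k\<in>A. blinfun_apply (ideal_component \<phi> (u k)) x)"
    by (intro tendsto_sum ideal_component_tendsto \<phi> u x)
  have "(\<Sum>k\<in>A. blinfun_apply \<phi> (inf x (real n *\<^sub>R u k))) \<le> blinfun_apply \<phi> x" for n
  proof -
    have nonneg: "0 \<le> real n *\<^sub>R u k" for k using u by (simp add: scaleR_nonneg_nonneg)
    have "(\<Sum>k\<in>A. inf x (real n *\<^sub>R u k)) \<le> x"
    proof (rule sum_disjoint_le[OF \<open>finite A\<close> x])
      fix i j :: nat assume "i \<noteq> j"
      have "inf (inf x (real n *\<^sub>R u i)) (inf x (real n *\<^sub>R u j)) \<le>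
          inf (inf x (real n *\<^sub>R u i)) (real n *\<^sub>R u j)"
        by (intro inf_mono order_refl) simp
      also have "\<dots> = 0"
        by (intro inf_scaleR_nat_eq_0 inf_scaleR_nat_disjoint) (use u x nonneg \<open>i \<noteq> j\<close> in auto)
      finally show "inf (inf x (real n *\<^sub>R u i)) (inf x (real n *\<^sub>R u j)) = 0"
        by (rule order.antisym) (use x nonneg in simp)
    qed (use x nonneg in auto)
    from positive_functional_mono[OF \<phi> this] show ?thesis by (simp add: blinfun.sum_right)
  qed
  then show "\<exists>N. \<forall>n\<ge>N. (\<Sum>k\<in>A. blinfun_apply \<phi> (inf x (real n *\<^sub>R u k))) \<le> blinfun_apply \<phi> x"
    by blast
qed


section \<open>The dual as a Banach lattice\<close>

text \<open>
  The type of all bounded linear maps between normed spaces carries no order, as the range need not be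
  ordered.  A copy of the dual can be made an instance of the class of Banach lattices, so that whatever
  holds in Banach lattices applies to the dual itself, whose functionals form the bidual.
\<close>

typedef (overloaded) 'a order_dual = "UNIV :: 'a::banach_lattice dual set"
  morphisms functional order_dual ..

setup_lifting type_definition_order_dual

instantiation order_dual :: (banach_lattice) real_normed_vector
begin

lift_definition zero_order_dual :: "'a order_dual" is "0 :: 'a dual" .
lift_definition plus_order_dual :: "'a order_dual \<Rightarrow> 'a order_dual \<Rightarrow> 'a order_dual"
  is "(+) :: 'a dual \<Rightarrow> 'a dual \<Rightarrow> 'a dual" .
lift_definition minus_order_dual :: "'a order_dual \<Rightarrow> 'a order_dual \<Rightarrow> 'a order_dual"
  is "(-) :: 'a dual \<Rightarrow> 'a dual \<Rightarrow> 'a dual" .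
lift_definition uminus_order_dual :: "'a order_dual \<Rightarrow> 'a order_dual"
  is "uminus :: 'a dual \<Rightarrow> 'a dual" .
lift_definition scaleR_order_dual :: "real \<Rightarrow> 'a order_dual \<Rightarrow> 'a order_dual"
  is "(*\<^sub>R) :: real \<Rightarrow> 'a dual \<Rightarrow> 'a dual" .
lift_definition norm_order_dual :: "'a order_dual \<Rightarrow> real" is "norm :: 'a dual \<Rightarrow> real" .

definition sgn_order_dual :: "'a order_dual \<Rightarrow> 'a order_dual" where
  "sgn_order_dual f = inverse (norm f) *\<^sub>R f"

definition dist_order_dual :: "'a order_dual \<Rightarrow> 'a order_dual \<Rightarrow> real" where
  "dist_order_dual f g = norm (f - g)"

definition uniformity_order_dual :: "('a order_dual \<times> 'a order_dual) filter" where
  "uniformity_order_dual = (INF e\<in>{0<..}. principal {(f, g). dist f g < e})"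

definition open_order_dual :: "'a order_dual set \<Rightarrow> bool" where
  "open_order_dual S \<longleftrightarrow> (\<forall>f\<in>S. \<forall>\<^sub>F (f', g) in uniformity. f' = f \<longrightarrow> g \<in> S)"

instance
proof
  fix f g h :: "'a order_dual" and a b :: real
  show "dist f g = norm (f - g)" by (rule dist_order_dual_def)
  show "sgn f = inverse (norm f) *\<^sub>R f" by (rule sgn_order_dual_def)
  show "uniformity = (INF e\<in>{0<..}. principal {(f, g :: 'a order_dual). dist f g < e})"
    by (rule uniformity_order_dual_def)
  show "open S \<longleftrightarrow> (\<forall>f\<in>S. \<forall>\<^sub>F (f', g) in uniformity. f' = f \<longrightarrow> g \<in> S)"
    for S :: "'a order_dual set" by (rule open_order_dual_def)
  show "f + g + h = f + (g + h)" by transfer (rule add.assoc)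
  show "f + g = g + f" by transfer (rule add.commute)
  show "0 + f = f" by transfer simp
  show "- f + f = 0" by transfer simp
  show "f - g = f + - g" by transfer simp
  show "a *\<^sub>R (f + g) = a *\<^sub>R f + a *\<^sub>R g" by transfer (rule scaleR_add_right)
  show "(a + b) *\<^sub>R f = a *\<^sub>R f + b *\<^sub>R f" by transfer (rule scaleR_add_left)
  show "a *\<^sub>R b *\<^sub>R f = (a * b) *\<^sub>R f" by transfer simp
  show "1 *\<^sub>R f = f" by transfer simp
  show "norm f = 0 \<longleftrightarrow> f = 0" by transfer simp
  show "norm (f + g) \<le> norm f + norm g" by transfer (rule norm_triangle_ineq)
  show "norm (a *\<^sub>R f) = \<bar>a\<bar> * norm f" by transfer simp
qed

end

instance order_dual :: (banach_lattice) banach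
proof
  fix X :: "nat \<Rightarrow> 'a order_dual"
  assume "Cauchy X"
  have dist: "dist f g = dist (functional f) (functional g)" for f g :: "'a order_dual"
    by (simp add: dist_norm norm_order_dual.rep_eq minus_order_dual.rep_eq)
  from \<open>Cauchy X\<close> have "Cauchy (\<lambda>n. functional (X n))"
    unfolding Cauchy_def dist .
  then obtain L where "(\<lambda>n. functional (X n)) \<longlonglongrightarrow> L"
    using Cauchy_convergent convergent_def by blast
  then have "X \<longlonglongrightarrow> order_dual L"
    by (simp add: lim_sequentially dist order_dual_inverse)
  then show "convergent X" by (rule convergentI)
qed

instantiation order_dual :: (banach_lattice) lattice_ab_group_add_abs
begin

lift_definition less_eq_order_dual :: "'a order_dual \<Rightarrow> 'a order_dual \<Rightarrow> bool" is dual_le .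
lift_definition less_order_dual :: "'a order_dual \<Rightarrow> 'a order_dual \<Rightarrow> bool" is dual_less .
lift_definition inf_order_dual :: "'a order_dual \<Rightarrow> 'a order_dual \<Rightarrow> 'a order_dual" is dual_inf .
lift_definition sup_order_dual :: "'a order_dual \<Rightarrow> 'a order_dual \<Rightarrow> 'a order_dual" is dual_sup .
lift_definition abs_order_dual :: "'a order_dual \<Rightarrow> 'a order_dual" is dual_abs .

instance
proof
  interpret d: lattice_ab_group_add_abs dual_abs "(+)" 0 "(-)" uminus
    dual_le dual_less dual_inf "dual_sup :: 'a dual \<Rightarrow> _"
    by (rule dual_lattice_ab_group_add_abs)
  fix f g h :: "'a order_dual"
  show "f < g \<longleftrightarrow> f \<le> g \<and> \<not> g \<le> f" by transfer (rule d.less_le_not_le)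
  show "f \<le> f" by transfer (rule d.order_refl)
  show "f \<le> g \<Longrightarrow> g \<le> h \<Longrightarrow> f \<le> h" by transfer (rule d.order_trans)
  show "f \<le> g \<Longrightarrow> g \<le> f \<Longrightarrow> f = g" by transfer (rule d.order.antisym)
  show "f \<le> g \<Longrightarrow> h + f \<le> h + g" by transfer (rule d.add_left_mono)
  show "inf f g \<le> f" by transfer (rule d.inf_le1)
  show "inf f g \<le> g" by transfer (rule d.inf_le2)
  show "f \<le> g \<Longrightarrow> f \<le> h \<Longrightarrow> f \<le> inf g h" by transfer (rule d.inf_greatest)
  show "f \<le> sup f g" by transfer (rule d.sup_ge1)
  show "g \<le> sup f g" by transfer (rule d.sup_ge2)
  show "g \<le> f \<Longrightarrow> h \<le> f \<Longrightarrow> sup g h \<le> f" by transfer (rule d.sup_least)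
  show "\<bar>f\<bar> = sup f (- f)" by transfer (rule d.abs_lattice)
qed

end

lemma functional_abs_le:
  fixes f :: "'a::banach_lattice dual"
  shows "\<bar>blinfun_apply f x\<bar> \<le> blinfun_apply (dual_abs f) \<bar>x\<bar>"
proof -
  have le: "blinfun_apply f z \<le> blinfun_apply (dual_abs f) z"
    "- blinfun_apply f z \<le> blinfun_apply (dual_abs f) z" if "0 \<le> z" for z
    using dual_sup_lub[of f "- f"] that by (auto simp: dual_abs_def dual_le_def blinfun.minus_left)
  have "0 \<le> - nprt x" by simp
  have eq: "blinfun_apply f x = blinfun_apply f (pprt x) - blinfun_apply f (- nprt x)"
    by (subst pprt_minus_nprt) (simp only: blinfun.diff_right)
  have "blinfun_apply (dual_abs f) \<bar>x\<bar> =
      blinfun_apply (dual_abs f) (pprt x) + blinfun_apply (dual_abs f) (- nprt x)"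
    by (simp add: abs_prts blinfun.diff_right blinfun.minus_right)
  with eq le[OF zero_le_pprt[of x]] le[OF \<open>0 \<le> - nprt x\<close>] show ?thesis by linarith
qed

text \<open>
  With \<open>h = f\<^sup>+\<close> we have \<open>|f| \<le> 2 h - f\<close>, and \<open>(2 h - f) x\<close> is the supremum of \<open>f (2 y - x)\<close> over \<open>0 \<le> y \<le> x\<close>,
  where \<open>|2 y - x| \<le> x\<close>.
\<close>

lemma dual_abs_apply_le_norm:
  fixes f :: "'a::banach_lattice dual"
  assumes x: "0 \<le> x"
  shows "blinfun_apply (dual_abs f) x \<le> norm f * norm x"
proof -
  obtain h :: "'a dual" where h: "dual_le f h" "dual_le 0 h"
    and least: "\<And>x c. 0 \<le> x \<Longrightarrow> (\<And>y. 0 \<le> y \<Longrightarrow> y \<le> x \<Longrightarrow> blinfun_apply f y \<le> c) \<Longrightarrow> blinfun_apply h x \<le> c"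
    by (rule positive_part_functional[of f]) blast
  have "dual_le f (h + h - f)" "dual_le (- f) (h + h - f)"
    using h by (auto simp: dual_le_def blinfun.bilinear_simps intro: add_mono)
  then have "dual_le (dual_abs f) (h + h - f)"
    using dual_sup_lub[of f "- f"] by (simp add: dual_abs_def)
  then have 1: "blinfun_apply (dual_abs f) x \<le> 2 * blinfun_apply h x - blinfun_apply f x"
    using x by (simp add: dual_le_def blinfun.bilinear_simps)
  have "blinfun_apply h x \<le> (norm f * norm x + blinfun_apply f x) / 2"
  proof (rule least[OF x])
    fix y assume y: "0 \<le> y" "y \<le> x"
    have "y + y - x \<le> x" "- (y + y - x) \<le> x" 
      using y by (auto simp: algebra_simps intro: add_mono add_increasing)
    then have "\<bar>y + y - x\<bar> \<le> \<bar>x\<bar>" using x by (auto intro!: abs_leI simp: abs_of_nonneg)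
    then have "norm (y + y - x) \<le> norm x" by (rule norm_mono_abs)
    then have "blinfun_apply f (y + y - x) \<le> norm f * norm x"
      using norm_blinfun[of f "y + y - x"] mult_left_mono[of "norm (y + y - x)" "norm x" "norm f"]
      by (smt (verit) norm_ge_zero real_norm_def)
    then show "blinfun_apply f y \<le> (norm f * norm x + blinfun_apply f x) / 2"
      by (simp add: blinfun.bilinear_simps)
  qed
  with 1 show ?thesis by simp
qed

instance order_dual :: (banach_lattice) banach_lattice
proof
  fix f g :: "'a order_dual" and a b :: real
  show "f \<le> g \<Longrightarrow> 0 \<le> a \<Longrightarrow> a *\<^sub>R f \<le> a *\<^sub>R g"
    by transfer (simp add: dual_le_def blinfun.scaleR_left mult_left_mono)
  show "a \<le> b \<Longrightarrow> 0 \<le> f \<Longrightarrow> a *\<^sub>R f \<le> b *\<^sub>R f"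
    by transfer (simp add: dual_le_def blinfun.scaleR_left mult_right_mono)
  show "norm f \<le> norm g" if "\<bar>f\<bar> \<le> \<bar>g\<bar>"
    using that
  proof transfer
    fix f g :: "'a dual"
    assume le: "dual_le (dual_abs f) (dual_abs g)"
    show "norm f \<le> norm g"
    proof (rule norm_blinfun_bound)
      fix x
      have "\<bar>blinfun_apply f x\<bar> \<le> blinfun_apply (dual_abs f) \<bar>x\<bar>" by (rule functional_abs_le)
      also have "\<dots> \<le> blinfun_apply (dual_abs g) \<bar>x\<bar>" using le by (simp add: dual_le_def)
      also have "\<dots> \<le> norm g * norm x" using dual_abs_apply_le_norm[of "\<bar>x\<bar>" g] by simp
      finally show "norm (blinfun_apply f x) \<le> norm g * norm x" by simp
    qed simp
  qed
qed

lemma bounded_linear_order_dual: "bounded_linear order_dual"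
  by (rule bounded_linear_intro[where K = 1])
    (simp_all add: plus_order_dual.abs_eq scaleR_order_dual.abs_eq norm_order_dual.abs_eq)

lemma bounded_linear_functional: "bounded_linear functional"
  by (rule bounded_linear_intro[where K = 1])
    (simp_all add: plus_order_dual.rep_eq scaleR_order_dual.rep_eq norm_order_dual.rep_eq)

lemma dual_abs_nonneg_eq:
  fixes f :: "'a::banach_lattice dual"
  assumes "dual_le 0 f"
  shows "dual_abs f = f"
proof -
  interpret d: lattice_ab_group_add_abs dual_abs "(+)" 0 "(-)" uminus
    dual_le dual_less dual_inf "dual_sup :: 'a dual \<Rightarrow> _"
    by (rule dual_lattice_ab_group_add_abs)
  show ?thesis using assms by (rule d.abs_of_nonneg)
qed

lemma dual_positive_minus_negative_part:
  fixes f :: "'a::banach_lattice dual"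
  shows "f = dual_sup f 0 - dual_sup (- f) 0"
proof -
  have "order_dual f = pprt (order_dual f) - pprt (- order_dual f)"
    using pprt_minus_nprt[of "order_dual f"] by (simp only: pprt_neg)
  then have "functional (order_dual f) = functional (pprt (order_dual f) - pprt (- order_dual f))"
    by (rule arg_cong)
  then show ?thesis
    by (simp only: pprt_def order_dual_inverse[OF UNIV_I] minus_order_dual.rep_eq sup_order_dual.rep_eq
        uminus_order_dual.rep_eq zero_order_dual.rep_eq)
qed


section \<open>A gliding hump lemma\<close>

text \<open>
  This is the part of Schur's theorem on weak convergence in \<open>\<ell>\<^sup>1\<close> that concerns the diagonal.  If the
  diagonal stayed above \<open>\<epsilon>\<close>, one could choose indices \<open>r\<^sub>0 < r\<^sub>1 < \<dots>\<close> with large diagonal entries so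
  sparsely that in row \<open>r\<^sub>m\<close>, \<open>m \<ge> 1\<close>, the columns up to \<open>r\<^sub>m\<^sub>-\<^sub>1\<close> and those from \<open>r\<^sub>m\<^sub>+\<^sub>1\<close> on contribute less than
  \<open>\<epsilon> / 4\<close> each.  Over the columns \<open>{r\<^sub>i}\<close> these rows then sum to at least \<open>\<epsilon> / 2\<close>.
\<close>

lemma diagonal_tendsto_zero:
  fixes a :: "nat \<Rightarrow> nat \<Rightarrow> real"
  assumes summ: "\<And>j. summable (\<lambda>k. \<bar>a j k\<bar>)"
    and null: "\<And>A. (\<lambda>j. \<Sum>k. if k \<in> A then a j k else 0) \<longlonglongrightarrow> 0"
  shows "(\<lambda>k. a k k) \<longlonglongrightarrow> 0"
proof (rule ccontr)
  assume "\<not> ?thesis"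
  then obtain \<epsilon> where \<epsilon>: "\<epsilon> > 0" and inf: "\<And>N. \<exists>n\<ge>N. \<epsilon> \<le> \<bar>a n n\<bar>"
    unfolding LIMSEQ_iff by (auto simp: not_less)
  have col: "(\<lambda>j. a j k) \<longlonglongrightarrow> 0" for k
  proof -
    have "(\<Sum>i. if i \<in> {k} then a j i else 0) = a j k" for j
      by (subst suminf_finite[of "{k}"]) auto
    then show ?thesis using null[of "{k}"] by simp
  qed
  \<comment> \<open>The successor \<open>j'\<close> of \<open>j\<close> starts a negligible tail of row \<open>j\<close>, and its row has a negligible head up to \<open>j\<close>.\<close>
  have "\<exists>j'. \<epsilon> \<le> \<bar>a j' j'\<bar> \<and> (j < j' \<and> (\<Sum>k. \<bar>a j (k + j')\<bar>) < \<epsilon> / 4 \<and> (\<Sum>k\<le>j. \<bar>a j' k\<bar>) < \<epsilon> / 4)" for j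
  proof -
    obtain N1 where N1: "\<And>n. n \<ge> N1 \<Longrightarrow> norm (\<Sum>k. \<bar>a j (k + n)\<bar>) < \<epsilon> / 4"
      using suminf_exist_split[of "\<epsilon> / 4" "\<lambda>k. \<bar>a j k\<bar>"] \<epsilon> summ by auto
    have "(\<lambda>j'. \<Sum>k\<le>j. \<bar>a j' k\<bar>) \<longlonglongrightarrow> (\<Sum>k\<le>j. \<bar>0\<bar>)"
      by (intro tendsto_sum tendsto_rabs col)
    then have "\<forall>\<^sub>F j' in sequentially. (\<Sum>k\<le>j. \<bar>a j' k\<bar>) < \<epsilon> / 4"
      by (rule order_tendstoD(2)) (use \<epsilon> in simp)
    then obtain N2 where N2: "\<And>n. n \<ge> N2 \<Longrightarrow> (\<Sum>k\<le>j. \<bar>a n k\<bar>) < \<epsilon> / 4"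
      unfolding eventually_sequentially by blast
    obtain j' where j': "j' \<ge> max (Suc j) (max N1 N2)" "\<epsilon> \<le> \<bar>a j' j'\<bar>" using inf by blast
    then show ?thesis using N1[of j'] N2[of j'] by (intro exI[of _ j']) auto
  qed
  moreover have "\<exists>j. \<epsilon> \<le> \<bar>a j j\<bar>" using inf by blast
  ultimately obtain r where r: "\<And>m. \<epsilon> \<le> \<bar>a (r m) (r m)\<bar>" "\<And>m. r m < r (Suc m)"
    "\<And>m. (\<Sum>k. \<bar>a (r m) (k + r (Suc m))\<bar>) < \<epsilon> / 4" "\<And>m. (\<Sum>k\<le>r m. \<bar>a (r (Suc m)) k\<bar>) < \<epsilon> / 4"
    using dependent_nat_choice[of "\<lambda>_ j. \<epsilon> \<le> \<bar>a j j\<bar>"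
        "\<lambda>_ j j'. j < j' \<and> (\<Sum>k. \<bar>a j (k + j')\<bar>) < \<epsilon> / 4 \<and> (\<Sum>k\<le>j. \<bar>a j' k\<bar>) < \<epsilon> / 4"] by blast
  have mono: "strict_mono r" using r(2) by (simp add: strict_mono_Suc_iff)
  have large: "\<epsilon> / 2 \<le> \<bar>\<Sum>k. if k \<in> range r then a (r (Suc m)) k else 0\<bar>" for m
  proof -
    define j where "j = r (Suc m)"
    define J where "J = r (Suc (Suc m))"
    define f where "f k = (if k \<in> range r then a j k else 0)" for k
    have fa: "\<bar>f k\<bar> \<le> \<bar>a j k\<bar>" for k by (simp add: f_def)
    have f_summ: "summable (\<lambda>k. \<bar>f k\<bar>)"
      by (rule summable_comparison_test'[OF summ[of j]]) (simp add: f_def)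
    have "suminf f = (\<Sum>k. f (k + J)) + (\<Sum>k<J. f k)"
      by (rule suminf_split_initial_segment) (rule summable_rabs_cancel[OF f_summ])
    moreover have "\<bar>\<Sum>k. f (k + J)\<bar> < \<epsilon> / 4"
    proof -
      have s: "summable (\<lambda>k. \<bar>f (k + J)\<bar>)" "summable (\<lambda>k. \<bar>a j (k + J)\<bar>)"
        using f_summ summ[of j] by (simp_all add: summable_iff_shift[of "\<lambda>k. \<bar>f k\<bar>"]
            summable_iff_shift[of "\<lambda>k. \<bar>a j k\<bar>"])
      have "\<bar>\<Sum>k. f (k + J)\<bar> \<le> (\<Sum>k. \<bar>f (k + J)\<bar>)" by (rule summable_rabs[OF s(1)])
      also have "\<dots> \<le> (\<Sum>k. \<bar>a j (k + J)\<bar>)" by (rule suminf_le[OF fa s])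
      also have "\<dots> < \<epsilon> / 4" using r(3)[of "Suc m"] by (simp add: j_def J_def)
      finally show ?thesis .
    qed
    \<comment> \<open>Below \<open>J\<close> the chosen columns are \<open>j\<close> itself and columns up to \<open>r m\<close>.\<close>
    moreover have "(\<Sum>k<J. f k) = (\<Sum>k\<in>insert j {..r m}. f k)"
    proof (rule sum.mono_neutral_right)
      show "insert j {..r m} \<subseteq> {..<J}" using r(2)[of m] r(2)[of "Suc m"] by (auto simp: j_def J_def)
      show "\<forall>k\<in>{..<J} - insert j {..r m}. f k = 0"
      proof
        fix k assume k: "k \<in> {..<J} - insert j {..r m}"
        have "k \<notin> range r"
        proof
          assume "k \<in> range r"
          then obtain i where i: "k = r i" by blast
          have "i \<noteq> Suc m" using k i by (auto simp: j_def)
          moreover have "r i < r (Suc (Suc m))" "r m < r i" using k i by (auto simp: J_def)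
          then have "i < Suc (Suc m)" "m < i" using strict_mono_less[OF mono] by blast+
          ultimately show False by simp
        qed
        then show "f k = 0" by (simp add: f_def)
      qed
    qed simp
    moreover have "(\<Sum>k\<in>insert j {..r m}. f k) = a j j + (\<Sum>k\<le>r m. f k)"
      using r(2)[of m] by (subst sum.insert) (auto simp: j_def f_def)
    moreover have "\<bar>\<Sum>k\<le>r m. f k\<bar> < \<epsilon> / 4"
    proof -
      have "\<bar>\<Sum>k\<le>r m. f k\<bar> \<le> (\<Sum>k\<le>r m. \<bar>a j k\<bar>)" by (rule order_trans[OF sum_abs sum_mono[OF fa]])
      with r(4)[of m] show ?thesis by (simp add: j_def)
    qed
    ultimately have "\<epsilon> / 2 \<le> \<bar>suminf f\<bar>" using r(1)[of "Suc m"] unfolding j_def by linarith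
    then show ?thesis unfolding f_def j_def .
  qed
  have "(\<lambda>m. \<Sum>k. if k \<in> range r then a (r (Suc m)) k else 0) \<longlonglongrightarrow> 0"
    by (rule LIMSEQ_subseq_LIMSEQ[OF null[of "range r"], of "\<lambda>m. r (Suc m)", unfolded o_def])
      (use mono in \<open>auto simp: strict_mono_def\<close>)
  then have "\<forall>\<^sub>F m in sequentially. \<bar>\<Sum>k. if k \<in> range r then a (r (Suc m)) k else 0\<bar> < \<epsilon> / 2"
    by (intro order_tendstoD(2)[OF tendsto_rabs_zero]) (use \<epsilon> in auto)
  then obtain m where "\<bar>\<Sum>k. if k \<in> range r then a (r (Suc m)) k else 0\<bar> < \<epsilon> / 2"
    by (auto simp: eventually_sequentially)
  with large[of m] show False by linarith
qed


section \<open>Disjoint minorants of weakly null sequences\<close>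

lemma weakly_null_bounded_linear:
  assumes T: "bounded_linear T" and g: "weakly_null g"
  shows "weakly_null (\<lambda>n. T (g n))"
  unfolding weakly_null_def
proof
  fix \<phi> :: "'b dual"
  have "(\<lambda>n. blinfun_apply (\<phi> o\<^sub>L Blinfun T) (g n)) \<longlonglongrightarrow> 0"
    using g unfolding weakly_null_def by blast
  then show "(\<lambda>n. blinfun_apply \<phi> (T (g n))) \<longlonglongrightarrow> 0"
    by (simp add: bounded_linear_Blinfun_apply[OF T])
qed

text \<open>
  The components \<open>\<theta>\<^sub>k\<close> of a positive functional \<open>\<phi>\<close> on the ideals of the \<open>u\<^sub>k\<close> satisfy
  \<open>\<Sum>\<^sub>k |\<theta>\<^sub>k x| \<le> \<phi> |x|\<close>.  Hence \<open>x \<mapsto> \<Sum>\<^sub>k\<^sub>\<in>\<^sub>A \<theta>\<^sub>k x\<close> is a bounded functional for every \<open>A\<close>, and the gliding hump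
  lemma applies to the matrix \<open>\<theta>\<^sub>k(g\<^sub>j)\<close>.  Its diagonal dominates \<open>\<phi>(u\<^sub>k)\<close>, since \<open>u\<^sub>k \<le> g\<^sub>k\<^sup>+\<close> is disjoint
  from \<open>g\<^sub>k\<^sup>-\<close>.
\<close>

lemma weakly_null_disjoint_minorant:
  fixes g u :: "nat \<Rightarrow> 'a::banach_lattice"
  assumes g: "weakly_null g"
    and u: "\<And>k. 0 \<le> u k" "\<And>j k. j \<noteq> k \<Longrightarrow> inf (u j) (u k) = 0" "\<And>k. u k \<le> pprt (g k)"
  shows "weakly_null u"
proof -
  have positive: "(\<lambda>k. blinfun_apply \<phi> (u k)) \<longlonglongrightarrow> 0" if \<phi>: "dual_le 0 \<phi>" for \<phi> :: "'a dual"
  proof -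
    define \<theta> where "\<theta> k = ideal_component \<phi> (u k)" for k
    have \<theta>: "dual_le 0 (\<theta> k)" for k unfolding \<theta>_def by (rule ideal_component_nonneg[OF \<phi> u(1)])
    have bound: "(\<Sum>k\<in>B. \<bar>blinfun_apply (\<theta> k) x\<bar>) \<le> norm x * norm \<phi>" if "finite B" for B x
    proof -
      have "(\<Sum>k\<in>B. \<bar>blinfun_apply (\<theta> k) x\<bar>) \<le> (\<Sum>k\<in>B. blinfun_apply (\<theta> k) \<bar>x\<bar>)"
        by (intro sum_mono positive_functional_abs_le \<theta>)
      also have "\<dots> \<le> blinfun_apply \<phi> \<bar>x\<bar>"
        unfolding \<theta>_def by (rule sum_ideal_components_le[OF \<phi> u(1,2) that]) simp_all
      also have "\<dots> \<le> norm x * norm \<phi>" using norm_blinfun[of \<phi> "\<bar>x\<bar>"] by (simp add: mult.commute)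
      finally show ?thesis .
    qed
    have summ: "summable (\<lambda>k. \<bar>blinfun_apply (\<theta> k) x\<bar>)" for x
      by (rule bounded_imp_summable[of _ "norm x * norm \<phi>"]) (use bound in auto)
    have "(\<lambda>k. blinfun_apply (\<theta> k) (g k)) \<longlonglongrightarrow> 0"
    proof (rule diagonal_tendsto_zero[of "\<lambda>j k. blinfun_apply (\<theta> k) (g j)"])
      show "summable (\<lambda>k. \<bar>blinfun_apply (\<theta> k) (g j)\<bar>)" for j by (rule summ)
      fix A :: "nat set"
      define S where "S x = (\<Sum>k. if k \<in> A then blinfun_apply (\<theta> k) x else 0)" for x
      have summA: "summable (\<lambda>k. \<bar>if k \<in> A then blinfun_apply (\<theta> k) x else 0\<bar>)" for x
        by (rule summable_comparison_test'[OF summ[of x]]) simp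
      have summA': "summable (\<lambda>k. if k \<in> A then blinfun_apply (\<theta> k) x else 0)" for x
        by (rule summable_rabs_cancel[OF summA])
      have "bounded_linear S"
      proof (rule bounded_linear_intro)
        show "S (x + y) = S x + S y" for x y
          unfolding S_def by (subst suminf_add[OF summA' summA'])
            (auto intro!: suminf_cong simp: blinfun.add_right)
        show "S (c *\<^sub>R x) = c *\<^sub>R S x" for c x
          unfolding S_def real_scaleR_def by (subst suminf_mult[OF summA', symmetric])
            (auto intro!: suminf_cong simp: blinfun.scaleR_right)
        show "norm (S x) \<le> norm x * norm \<phi>" for x
        proof -
          have "norm (S x) \<le> (\<Sum>k. \<bar>if k \<in> A then blinfun_apply (\<theta> k) x else 0\<bar>)"
            unfolding S_def real_norm_def by (rule summable_rabs[OF summA])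
          also have "\<dots> \<le> (\<Sum>k. \<bar>blinfun_apply (\<theta> k) x\<bar>)"
            by (rule suminf_le[OF _ summA summ]) simp
          also have "\<dots> \<le> norm x * norm \<phi>"
            by (rule suminf_le_const[OF summ]) (use bound in auto)
          finally show ?thesis .
        qed
      qed
      then have "blinfun_apply (Blinfun S) = S" by (rule bounded_linear_Blinfun_apply)
      with g have "(\<lambda>j. S (g j)) \<longlonglongrightarrow> 0" unfolding weakly_null_def by metis
      then show "(\<lambda>j. \<Sum>k. if k \<in> A then blinfun_apply (\<theta> k) (g j) else 0) \<longlonglongrightarrow> 0"
        by (simp add: S_def)
    qed
    then show ?thesis
    proof (rule tendsto_sandwich[OF _ _ tendsto_const, rotated 2])
      have "0 \<le> blinfun_apply \<phi> (u k)" for k using \<phi> u(1) by (simp add: dual_le_def)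
      then show "\<forall>\<^sub>F k in sequentially. 0 \<le> blinfun_apply \<phi> (u k)" by simp
      have "blinfun_apply \<phi> (u k) \<le> blinfun_apply (\<theta> k) (g k)" for k
      proof -
        have "inf (pprt (g k)) (- nprt (g k)) = 0" by (rule inf_pprt_minus_nprt)
        then have "inf (- nprt (g k)) (u k) \<le> 0" 
          using inf_mono[OF order_refl u(3), of "- nprt (g k)" k] by (simp only: inf_commute)
        then have "inf (- nprt (g k)) (u k) = 0" using u(1) by (intro order.antisym) auto
        then have 0: "blinfun_apply (\<theta> k) (- nprt (g k)) = 0"
          unfolding \<theta>_def by (intro ideal_component_disjoint \<phi> u(1)) auto
        have "blinfun_apply \<phi> (u k) = blinfun_apply (\<theta> k) (u k)"
          unfolding \<theta>_def by (rule ideal_component_eq[symmetric]) (use \<phi> u(1) in auto)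
        also have "\<dots> \<le> blinfun_apply (\<theta> k) (pprt (g k))"
          by (rule positive_functional_mono[OF \<theta> u(3)])
        also have "\<dots> = blinfun_apply (\<theta> k) (pprt (g k) - (- nprt (g k)))"
          by (simp only: blinfun.diff_right 0 diff_zero)
        also have "\<dots> = blinfun_apply (\<theta> k) (g k)" using pprt_minus_nprt[of "g k"] by simp
        finally show ?thesis .
      qed
      then show "\<forall>\<^sub>F k in sequentially. blinfun_apply \<phi> (u k) \<le> blinfun_apply (\<theta> k) (g k)" by simp
    qed
  qed
  show ?thesis
    unfolding weakly_null_def
  proof
    fix \<phi> :: "'a dual"
    obtain h :: "'a dual" where "dual_le \<phi> h" "dual_le 0 h"
      by (rule positive_part_functional[of \<phi>])
    then have "dual_le 0 (h - \<phi>)" "dual_le 0 h" by (simp_all add: dual_le_def blinfun.diff_left)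
    from tendsto_diff[OF positive[OF this(2)] positive[OF this(1)]]
    show "(\<lambda>k. blinfun_apply \<phi> (u k)) \<longlonglongrightarrow> 0" by (simp add: blinfun.diff_left)
  qed
qed

lemma dual_weakly_null_disjoint_minorant:
  fixes g u :: "nat \<Rightarrow> 'a::banach_lattice dual"
  assumes g: "weakly_null g"
    and u: "\<And>k. dual_le 0 (u k)" "\<And>j k. j \<noteq> k \<Longrightarrow> dual_inf (u j) (u k) = 0"
      "\<And>k. dual_le (u k) (dual_sup (g k) 0)"
  shows "weakly_null u"
proof -
  have "weakly_null (\<lambda>k. order_dual (u k))"
  proof (rule weakly_null_disjoint_minorant)
    show "weakly_null (\<lambda>k. order_dual (g k))"
      by (rule weakly_null_bounded_linear[OF bounded_linear_order_dual g])
  qed (use u in \<open>simp_all add: pprt_def zero_order_dual_def less_eq_order_dual.abs_eq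
      inf_order_dual.abs_eq sup_order_dual.abs_eq\<close>)
  from weakly_null_bounded_linear[OF bounded_linear_functional this]
  show ?thesis by (simp add: order_dual_inverse)
qed


section \<open>Norming functionals and weakly bounded sequences\<close>

text \<open>
  Homogeneity is required in one direction only; the other follows by scaling with the inverse.
\<close>

definition sublinear :: "('a::real_vector \<Rightarrow> real) \<Rightarrow> bool" where
  "sublinear q \<longleftrightarrow> (\<forall>x y. q (x + y) \<le> q x + q y) \<and> (\<forall>c>0. \<forall>x. q (c *\<^sub>R x) \<le> c * q x)"

lemma sublinear_add: "sublinear q \<Longrightarrow> q (x + y) \<le> q x + q y"
  by (simp add: sublinear_def)

lemma sublinear_scaleR:
  assumes q: "sublinear q" and "0 \<le> c"
  shows "q (c *\<^sub>R x) = c * q x"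
proof (cases "c = 0")
  case True
  have le: "q (d *\<^sub>R 0) \<le> d * q 0" if "d > 0" for d
    using q that unfolding sublinear_def by (metis scaleR_zero_right)
  have "q 0 = 0" using le[of 2] le[of "1/2"] by simp
  with True show ?thesis by simp
next
  case False
  with \<open>0 \<le> c\<close> have c: "c > 0" by simp
  have "q (inverse c *\<^sub>R (c *\<^sub>R x)) \<le> inverse c * q (c *\<^sub>R x)"
    using q c unfolding sublinear_def by (metis positive_imp_inverse_positive)
  then have "c * q x \<le> q (c *\<^sub>R x)" using c by (simp add: field_simps)
  moreover have "q (c *\<^sub>R x) \<le> c * q x" using q c by (simp add: sublinear_def)
  ultimately show ?thesis by simp
qed

lemma sublinear_minus: "sublinear q \<Longrightarrow> - q (- x) \<le> q x"
  using sublinear_add[of q x "- x"] sublinear_scaleR[of q 0 0] by simp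

text \<open>
  The function \<open>r x = inf {q (x + t y) - t q y | t \<ge> 0}\<close> is a sublinear minorant of \<open>q\<close> that is made as
  small as possible at \<open>- y\<close>; taking \<open>t = 1\<close> there gives the last inequality.
\<close>

lemma sublinear_directional:
  fixes q :: "'a::real_vector \<Rightarrow> real"
  assumes q: "sublinear q"
  obtains r where "sublinear r" "\<And>x. r x \<le> q x" "r (- y) \<le> - q y"
proof -
  define S where "S x = (\<lambda>t. q (x + t *\<^sub>R y) - t * q y) ` {0..}" for x
  define r where "r x = Inf (S x)" for x
  have low: "- q (- x) \<le> q (x + t *\<^sub>R y) - t * q y" if "0 \<le> t" for x t
    using sublinear_add[OF q, of "x + t *\<^sub>R y" "- x"] sublinear_scaleR[OF q that, of y] by simp
  have "bdd_below (S x)" for x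
    unfolding S_def by (rule bdd_belowI2[where m = "- q (- x)"]) (use low in auto)
  then have le: "r x \<le> q (x + t *\<^sub>R y) - t * q y" if "0 \<le> t" for x t
    unfolding r_def by (rule cInf_lower[rotated]) (use that in \<open>auto simp: S_def\<close>)
  have greatest: "c \<le> r x" if "\<And>t. 0 \<le> t \<Longrightarrow> c \<le> q (x + t *\<^sub>R y) - t * q y" for c x
    unfolding r_def by (rule cInf_greatest) (use that in \<open>auto simp: S_def\<close>)
  have "r (u + v) \<le> r u + r v" for u v
  proof -
    have "r (u + v) - r v \<le> r u"
    proof (rule greatest)
      fix t :: real assume t: "0 \<le> t"
      have "r (u + v) - (q (u + t *\<^sub>R y) - t * q y) \<le> r v"
      proof (rule greatest)
        fix s :: real assume s: "0 \<le> s"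
        have "r (u + v) \<le> q (u + v + (t + s) *\<^sub>R y) - (t + s) * q y" by (rule le) (use s t in simp)
        moreover have "q (u + v + (t + s) *\<^sub>R y) \<le> q (u + t *\<^sub>R y) + q (v + s *\<^sub>R y)"
          using sublinear_add[OF q, of "u + t *\<^sub>R y" "v + s *\<^sub>R y"] by (simp add: algebra_simps)
        ultimately show "r (u + v) - (q (u + t *\<^sub>R y) - t * q y) \<le> q (v + s *\<^sub>R y) - s * q y"
          by (simp add: algebra_simps)
      qed
      then show "r (u + v) - r v \<le> q (u + t *\<^sub>R y) - t * q y" by simp
    qed
    then show ?thesis by simp
  qed
  moreover have "r (c *\<^sub>R x) \<le> c * r x" if c: "c > 0" for c x
  proof -
    have "r (c *\<^sub>R x) / c \<le> r x"
    proof (rule greatest)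
      fix t :: real assume t: "0 \<le> t"
      have "r (c *\<^sub>R x) \<le> q (c *\<^sub>R x + (c * t) *\<^sub>R y) - (c * t) * q y" by (rule le) (use c t in simp)
      also have "q (c *\<^sub>R x + (c * t) *\<^sub>R y) = c * q (x + t *\<^sub>R y)"
        using sublinear_scaleR[OF q, of c "x + t *\<^sub>R y"] c by (simp add: scaleR_add_right)
      finally show "r (c *\<^sub>R x) / c \<le> q (x + t *\<^sub>R y) - t * q y" using c by (simp add: field_simps)
    qed
    then show ?thesis using c by (simp add: field_simps)
  qed
  ultimately have "sublinear r" by (simp add: sublinear_def)
  moreover have "r x \<le> q x" for x using le[of 0 x] by simp
  moreover have "r (- y) \<le> - q y" using le[of 1 "- y"] sublinear_scaleR[OF q, of 0 0] by simp
  ultimately show ?thesis by (rule that)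
qed

text \<open>
  Pointwise infima of chains of sublinear functions are sublinear; they are finite because
  \<open>q x \<ge> - q (- x) \<ge> - p (- x)\<close> for each sublinear \<open>q \<le> p\<close>.
\<close>

lemma exists_minimal_sublinear:
  fixes p :: "'a::real_vector \<Rightarrow> real"
  assumes p: "sublinear p"
  obtains q where "sublinear q" "q \<le> p" "\<And>r. sublinear r \<Longrightarrow> r \<le> q \<Longrightarrow> r = q"
proof -
  define A where "A = {q. sublinear q \<and> q \<le> p}"
  have "\<exists>q\<in>A. \<forall>r\<in>A. r \<le> q \<longrightarrow> r = q"
  proof (rule predicate_Zorn[of A "\<lambda>q r. r \<le> q"])
    show "partial_order_on A (relation_of (\<lambda>q r. r \<le> q) A)"
      by (rule partial_order_on_relation_ofI) auto
    fix C assume "C \<in> Chains (relation_of (\<lambda>q r. r \<le> q) A)"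
    then have CA: "C \<subseteq> A" and chain: "\<And>q r. q \<in> C \<Longrightarrow> r \<in> C \<Longrightarrow> q \<le> r \<or> r \<le> q"
      by (auto simp: Chains_def relation_of_def)
    show "\<exists>u\<in>A. \<forall>q\<in>C. u \<le> q"
    proof (cases "C = {}")
      case True
      then show ?thesis using p by (auto simp: A_def)
    next
      case False
      define u where "u x = (INF q\<in>C. q x)" for x
      have sub: "sublinear q" and qp: "q x \<le> p x" if "q \<in> C" for q x
        using that CA by (auto simp: A_def le_fun_def)
      have "- p (- x) \<le> q x" if "q \<in> C" for q x
        using sublinear_minus[OF sub[OF that], of x] qp[OF that, of "- x"] by simp
      then have bdd: "bdd_below ((\<lambda>q. q x) ` C)" for x by (intro bdd_belowI2) auto
      have le: "u x \<le> q x" if "q \<in> C" for q x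
        unfolding u_def by (rule cINF_lower[OF bdd that])
      have greatest: "c \<le> u x" if "\<And>q. q \<in> C \<Longrightarrow> c \<le> q x" for c x
        unfolding u_def by (rule cINF_greatest[OF False that])
      have "u (x + y) \<le> u x + u y" for x y
      proof -
        have "u (x + y) - u y \<le> u x"
        proof (rule greatest)
          fix q assume q: "q \<in> C"
          have "u (x + y) - q x \<le> u y"
          proof (rule greatest)
            fix r assume r: "r \<in> C"
            obtain s where s: "s \<in> C" "s \<le> q" "s \<le> r" using chain[OF q r] q r by blast
            have "u (x + y) \<le> s x + s y"
              using le[OF s(1)] sublinear_add[OF sub[OF s(1)]] by (rule order_trans)
            also have "\<dots> \<le> q x + r y" using s by (intro add_mono) (auto simp: le_fun_def)
            finally show "u (x + y) - q x \<le> r y" by simp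
          qed
          then show "u (x + y) - u y \<le> q x" by simp
        qed
        then show ?thesis by simp
      qed
      moreover have "u (c *\<^sub>R x) \<le> c * u x" if c: "c > 0" for c x
      proof -
        have "u (c *\<^sub>R x) / c \<le> u x"
        proof (rule greatest)
          fix q assume q: "q \<in> C"
          have "u (c *\<^sub>R x) \<le> c * q x"
            using le[OF q, of "c *\<^sub>R x"] sublinear_scaleR[OF sub[OF q], of c x] c by simp
          then show "u (c *\<^sub>R x) / c \<le> q x" using c by (simp add: field_simps)
        qed
        then show ?thesis using c by (simp add: field_simps)
      qed
      ultimately have "sublinear u" by (simp add: sublinear_def)
      moreover obtain q where "q \<in> C" using False by blast
      then have "u \<le> p" using le qp by (meson le_funI order_trans)
      ultimately show ?thesis using le by (intro bexI[of _ u]) (auto simp: A_def le_fun_def)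
    qed
  qed
  then obtain q where q: "q \<in> A" "\<And>r. r \<in> A \<Longrightarrow> r \<le> q \<Longrightarrow> r = q" by blast
  show ?thesis
    by (rule that[of q]) (use q order_trans in \<open>auto simp: A_def\<close>)
qed

text \<open>
  The Hahn-Banach theorem for the norm.  A minimal sublinear function is odd, because its directional
  modification at any \<open>y\<close> cannot be smaller, and an odd sublinear function is linear.  Starting from the
  directional modification of the norm at \<open>x\<close> forces the value at \<open>x\<close> to be the norm.
\<close>

lemma norming_functional:
  fixes x :: "'a::real_normed_vector"
  obtains \<phi> :: "'a dual" where "norm \<phi> \<le> 1" "blinfun_apply \<phi> x = norm x"
proof -
  have "sublinear (norm :: 'a \<Rightarrow> real)" by (simp add: sublinear_def norm_triangle_ineq)
  then obtain p :: "'a \<Rightarrow> real" where p: "sublinear p" "\<And>z. p z \<le> norm z" "p (- x) \<le> - norm x"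
    using sublinear_directional[of norm x] by blast
  obtain q where q: "sublinear q" "q \<le> p" and min: "\<And>r. sublinear r \<Longrightarrow> r \<le> q \<Longrightarrow> r = q"
    using exists_minimal_sublinear[OF p(1)] by blast
  have odd: "q (- y) = - q y" for y
  proof -
    obtain r where "sublinear r" "\<And>z. r z \<le> q z" "r (- y) \<le> - q y"
      using sublinear_directional[OF q(1), of y] by blast
    with min[of r] have "q (- y) \<le> - q y" by (auto simp: le_fun_def)
    with sublinear_minus[OF q(1), of y] show ?thesis by simp
  qed
  have add: "q (y + z) = q y + q z" for y z
    using sublinear_add[OF q(1), of y z] sublinear_add[OF q(1), of "y + z" "- z"] odd[of z] by simp
  have scale: "q (c *\<^sub>R y) = c *\<^sub>R q y" for c y
    using sublinear_scaleR[OF q(1), of c y] sublinear_scaleR[OF q(1), of "- c" y] odd[of "c *\<^sub>R y"]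
    by (cases "c \<ge> 0") auto
  have le: "q z \<le> norm z" for z using q(2) p(2)[of z] by (auto simp: le_fun_def intro: order_trans)
  have bound: "norm (q z) \<le> norm z * 1" for z
    using le[of z] le[of "- z"] odd[of z] by simp
  have app: "blinfun_apply (Blinfun q) = q"
    by (rule bounded_linear_Blinfun_apply[OF bounded_linear_intro[OF add scale bound]])
  have "norm x \<le> q x" using odd[of x] q(2) p(3) by (auto simp: le_fun_def dest: spec[of _ "- x"])
  with le[of x] show ?thesis
    by (intro that[of "Blinfun q"] norm_blinfun_bound) (use bound in \<open>auto simp: app\<close>)
qed

text \<open>
  The functionals bounded by \<open>m\<close> on the sequence form closed sets which cover the dual.  By Baire's
  theorem one of them contains a ball, and norming functionals, shifted into that ball, bound the norms.
\<close>

lemma weakly_bounded_imp_bounded: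
  fixes x :: "nat \<Rightarrow> 'a::real_normed_vector"
  assumes weak: "\<And>\<phi> :: 'a dual. bounded (range (\<lambda>n. blinfun_apply \<phi> (x n)))"
  shows "bounded (range x)"
proof -
  define C where "C m = {\<phi> :: 'a dual. \<forall>n. \<bar>blinfun_apply \<phi> (x n)\<bar> \<le> real m}" for m
  have closed: "closed (C m)" for m
    unfolding C_def by (intro closed_Collect_all closed_Collect_le continuous_intros)
  have "\<exists>m. \<phi> \<in> C m" for \<phi>
  proof -
    obtain B where "\<And>n. \<bar>blinfun_apply \<phi> (x n)\<bar> \<le> B" using weak[of \<phi>] by (auto simp: bounded_iff)
    moreover obtain m where "B \<le> real m" using real_arch_simple by blast
    ultimately show ?thesis unfolding C_def by (auto intro: order_trans)
  qed
  then have cover: "\<Union>(range C) = UNIV" by auto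
  have "\<exists>m. interior (C m) \<noteq> {}"
  proof (rule ccontr)
    assume "\<not> ?thesis"
    then have "euclidean interior_of \<Union>(range C) = {}"
      by (intro Baire_category_alt) (auto simp: closed completely_metrizable_space_euclidean)
    then show False by (simp add: cover)
  qed
  then obtain m \<phi>0 where "\<phi>0 \<in> interior (C m)" by blast
  then obtain e where e: "e > 0" "cball \<phi>0 e \<subseteq> C m"
    unfolding mem_interior_cball by blast
  have "norm (x n) \<le> 2 * real m / e" for n
  proof -
    obtain \<phi> :: "'a dual" where \<phi>: "norm \<phi> \<le> 1" "blinfun_apply \<phi> (x n) = norm (x n)"
      by (rule norming_functional)
    have "dist \<phi>0 (\<phi>0 + e *\<^sub>R \<phi>) \<le> e" using \<phi>(1) e(1) by (simp add: dist_norm)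
    with e have "\<phi>0 + e *\<^sub>R \<phi> \<in> C m" "\<phi>0 \<in> C m" by auto
    then have "\<bar>blinfun_apply \<phi>0 (x n) + e * norm (x n)\<bar> \<le> real m" "\<bar>blinfun_apply \<phi>0 (x n)\<bar> \<le> real m"
      by (auto simp: C_def blinfun.add_left blinfun.scaleR_left simp flip: \<phi>(2))
    then have "e * norm (x n) \<le> 2 * real m" by linarith
    with e(1) show ?thesis by (simp add: field_simps)
  qed
  then show ?thesis by (auto simp: bounded_iff)
qed

lemma weakly_summable_imp_bounded:
  fixes x :: "nat \<Rightarrow> 'a::real_normed_vector"
  assumes x: "weakly_summable p x" and p: "p \<ge> 1"
  shows "bounded (range x)"
proof (rule weakly_bounded_imp_bounded)
  fix \<phi> :: "'a dual"
  have "(\<lambda>n. \<bar>blinfun_apply \<phi> (x n)\<bar> powr p) \<longlonglongrightarrow> 0"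
    using x by (intro summable_LIMSEQ_zero) (simp add: weakly_summable_def)
  then have "Bseq (\<lambda>n. \<bar>blinfun_apply \<phi> (x n)\<bar> powr p)" by (intro convergent_imp_Bseq convergentI)
  then obtain K where K: "K > 0" "\<And>n. \<bar>blinfun_apply \<phi> (x n)\<bar> powr p \<le> K"
    unfolding Bseq_def by auto
  have "\<bar>blinfun_apply \<phi> (x n)\<bar> \<le> max 1 K" for n
  proof (cases "\<bar>blinfun_apply \<phi> (x n)\<bar> \<le> 1")
    case False
    then have "\<bar>blinfun_apply \<phi> (x n)\<bar> powr 1 \<le> \<bar>blinfun_apply \<phi> (x n)\<bar> powr p"
      by (intro powr_mono) (use p in auto)
    with K(2)[of n] False show ?thesis by simp
  qed simp
  then show "bounded (range (\<lambda>n. blinfun_apply \<phi> (x n)))" by (auto simp: bounded_iff)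
qed


section \<open>The equivalences\<close>

lemma weakly_null_tendsto_apply:
  fixes f :: "nat \<Rightarrow> 'a::real_normed_vector dual"
  assumes "weakly_null f"
  shows "(\<lambda>n. blinfun_apply (f n) z) \<longlonglongrightarrow> 0"
proof -
  have "bounded_linear (\<lambda>h :: 'a dual. blinfun_apply h z)" by (rule blinfun.bounded_linear_left)
  \<comment> \<open>On the real line, weak convergence to zero is convergence, tested by the identity functional.\<close>
  from weakly_null_bounded_linear[OF this assms]
  have "(\<lambda>n. blinfun_apply id_blinfun (blinfun_apply (f n) z)) \<longlonglongrightarrow> 0"
    unfolding weakly_null_def by blast
  then show ?thesis by simp
qed

text \<open>
  On finitely many points \<open>x\<^sub>k\<close> a weakly null sequence is uniformly small, so the points at which it is large
  can be taken arbitrarily far out.  That the second subsequence is strictly increasing keeps the selected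
  points a subsequence of \<open>x\<close>, hence disjoint if \<open>x\<close> is.
\<close>

lemma not_uniformly_null_on_range:
  fixes f :: "nat \<Rightarrow> 'a::real_normed_vector dual" and x :: "nat \<Rightarrow> 'a"
  assumes f: "weakly_null f" and non: "\<not> uniformly_null_on (range x) f"
  obtains \<epsilon> :: real and r s :: "nat \<Rightarrow> nat" where "\<epsilon> > 0" "strict_mono r" "strict_mono s"
    "\<And>j. \<epsilon> \<le> \<bar>blinfun_apply (f (r j)) (x (s j))\<bar>"
proof -
  obtain \<epsilon> where \<epsilon>: "\<epsilon> > 0"
    and freq: "\<exists>\<^sub>F n in sequentially. \<exists>k. \<epsilon> \<le> \<bar>blinfun_apply (f n) (x k)\<bar>"
    using non by (auto simp: uniformly_null_on_def uniform_limit_iff frequently_def not_le)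
  have step: "\<exists>n k. N < n \<and> K < k \<and> \<epsilon> \<le> \<bar>blinfun_apply (f n) (x k)\<bar>" for N K
  proof -
    have "\<forall>\<^sub>F n in sequentially. \<bar>blinfun_apply (f n) (x k)\<bar> < \<epsilon>" for k
      using tendsto_rabs_zero[OF weakly_null_tendsto_apply[OF f, of "x k"]] \<epsilon>
      by (rule order_tendstoD(2))
    then have "\<forall>\<^sub>F n in sequentially. \<forall>k\<in>{..K}. \<bar>blinfun_apply (f n) (x k)\<bar> < \<epsilon>"
      by (intro eventually_ball_finite) auto
    with eventually_gt_at_top[of N]
    have "\<forall>\<^sub>F n in sequentially. N < n \<and> (\<forall>k\<in>{..K}. \<bar>blinfun_apply (f n) (x k)\<bar> < \<epsilon>)"
      by (rule eventually_conj)
    from frequently_ex[OF frequently_eventually_frequently[OF freq this]]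
    obtain n k where n: "N < n" "\<forall>k\<in>{..K}. \<bar>blinfun_apply (f n) (x k)\<bar> < \<epsilon>"
      "\<epsilon> \<le> \<bar>blinfun_apply (f n) (x k)\<bar>" by blast
    then have "K < k" by (force simp: not_le[symmetric])
    with n show ?thesis by blast
  qed
  define large where "large a \<longleftrightarrow> \<epsilon> \<le> \<bar>blinfun_apply (f (fst a)) (x (snd a))\<bar>" for a
  have "\<exists>h. \<forall>j::nat. large (h j) \<and> fst (h j) < fst (h (Suc j)) \<and> snd (h j) < snd (h (Suc j))"
  proof (rule dependent_nat_choice)
    show "\<exists>a. large a" using step[of 0 0] by (auto simp: large_def)
    show "\<exists>b. large b \<and> fst a < fst b \<and> snd a < snd b" for a
      using step[of "fst a" "snd a"] by (auto simp: large_def)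
  qed
  then obtain h where h: "\<And>j::nat. large (h j)"
    "\<And>j. fst (h j) < fst (h (Suc j))" "\<And>j. snd (h j) < snd (h (Suc j))" by blast
  show ?thesis
    by (rule that[of \<epsilon> "\<lambda>j. fst (h j)" "\<lambda>j. snd (h j)"])
      (use \<epsilon> h in \<open>auto simp: strict_mono_Suc_iff large_def\<close>)
qed

lemma weakly_null_subseq:
  assumes "weakly_null f" "strict_mono r"
  shows "weakly_null (\<lambda>j. f (r j))"
  using assms LIMSEQ_subseq_LIMSEQ[OF _ assms(2)] unfolding weakly_null_def o_def by blast

lemma weakly_summable_subseq:
  assumes "weakly_summable p x" "strict_mono s"
  shows "weakly_summable p (\<lambda>j. x (s j))"
  unfolding weakly_summable_def
proof
  fix \<phi> :: "'a dual"
  have "summable ((\<lambda>n. \<bar>blinfun_apply \<phi> (x n)\<bar> powr p) \<circ> s)"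
    by (rule summable_reindex)
      (use assms in \<open>auto simp: weakly_summable_def intro: strict_mono_imp_inj_on\<close>)
  then show "summable (\<lambda>j. \<bar>blinfun_apply \<phi> (x (s j))\<bar> powr p)" by (simp add: o_def)
qed

text \<open>
  A violation of the Dunford-Pettis condition by \<open>g\<^sub>j\<close> at disjoint points \<open>y\<^sub>j\<close> is inherited by the components
  of \<open>g\<^sub>j\<^sup>+\<close> or of \<open>g\<^sub>j\<^sup>-\<close> on the ideals of the \<open>|y\<^sub>j|\<close>, which agree with \<open>g\<^sub>j\<^sup>+\<close> and \<open>g\<^sub>j\<^sup>-\<close> at \<open>y\<^sub>j\<close>, and which
  form positive disjoint weakly null sequences.
\<close>

lemma disjoint_DPP_if_positive_disjoint:
  assumes hyp: "\<And>(x :: nat \<Rightarrow> 'a::banach_lattice) f. disjoint_seq x \<Longrightarrow> weakly_summable p x \<Longrightarrow>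
    dual_positive_seq f \<Longrightarrow> dual_disjoint_seq f \<Longrightarrow> weakly_null f \<Longrightarrow>
    (\<lambda>n. blinfun_apply (f n) (x n)) \<longlonglongrightarrow> 0"
  shows "disjoint_DPP p TYPE('a)"
proof (rule ccontr)
  assume "\<not> disjoint_DPP p TYPE('a)"
  then obtain x :: "nat \<Rightarrow> 'a" and f where x: "disjoint_seq x" "weakly_summable p x"
    and f: "weakly_null f" and non: "\<not> uniformly_null_on (range x) f"
    unfolding disjoint_DPP_def dunford_pettis_def by blast
  obtain \<epsilon> :: real and r s :: "nat \<Rightarrow> nat" where \<epsilon>: "\<epsilon> > 0" and rs: "strict_mono r" "strict_mono s"
    and large: "\<And>j. \<epsilon> \<le> \<bar>blinfun_apply (f (r j)) (x (s j))\<bar>"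
    by (rule not_uniformly_null_on_range[OF f non]) blast
  define y :: "nat \<Rightarrow> 'a" where "y j = x (s j)" for j
  have y: "disjoint_seq y" "weakly_summable p y"
    using x(1) strict_mono_eq[OF rs(2)] weakly_summable_subseq[OF x(2) rs(2)]
    by (auto simp: disjoint_seq_def y_def[abs_def])
  have pos: "(\<lambda>j. blinfun_apply (dual_sup (g j) 0) (y j)) \<longlonglongrightarrow> 0" if g: "weakly_null g" for g :: "nat \<Rightarrow> 'a dual"
  proof -
    define u where "u j = ideal_component (dual_sup (g j) 0) \<bar>y j\<bar>" for j
    have g0: "dual_le 0 (dual_sup (g j) 0)" for j using dual_sup_lub by blast
    have u0: "dual_le 0 (u j)" for j unfolding u_def by (intro ideal_component_nonneg g0) simp
    have udisj: "dual_inf (u i) (u j) = 0" if "i \<noteq> j" for i j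
      unfolding u_def by (intro dual_inf_ideal_component_eq_0 g0)
        (use y(1) that in \<open>auto simp: disjoint_seq_def\<close>)
    have "weakly_null u"
      by (rule dual_weakly_null_disjoint_minorant[OF g u0 udisj])
        (auto simp: u_def intro: ideal_component_le g0)
    moreover have "dual_positive_seq u" using u0 by (simp add: dual_positive_seq_def)
    moreover have "dual_disjoint_seq u"
      using udisj by (simp add: dual_disjoint_seq_def dual_abs_nonneg_eq[OF u0])
    ultimately have "(\<lambda>j. blinfun_apply (u j) (y j)) \<longlonglongrightarrow> 0" by (intro hyp y)
    then show ?thesis by (simp add: u_def ideal_component_abs_apply[OF g0])
  qed
  define g :: "nat \<Rightarrow> 'a dual" where "g j = f (r j)" for j
  have g: "weakly_null g" unfolding g_def by (rule weakly_null_subseq[OF f rs(1)])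
  have g': "weakly_null (\<lambda>j. - g j)"
    by (rule weakly_null_bounded_linear[OF bounded_linear_minus[OF bounded_linear_ident] g])
  have "(\<lambda>j. blinfun_apply (g j) (y j)) \<longlonglongrightarrow> 0"
  proof -
    have eq: "blinfun_apply (g j) z = blinfun_apply (dual_sup (g j) 0) z - blinfun_apply (dual_sup (- g j) 0) z" for j z
      using dual_positive_minus_negative_part[of "g j"] by (metis blinfun.diff_left)
    show ?thesis unfolding eq[of _ "y _"] using tendsto_diff[OF pos[OF g] pos[OF g']] by simp
  qed
  then have "\<forall>\<^sub>F j in sequentially. \<bar>blinfun_apply (g j) (y j)\<bar> < \<epsilon>"
    by (intro order_tendstoD(2)[OF tendsto_rabs_zero]) (use \<epsilon> in auto)
  then obtain j where "\<bar>blinfun_apply (g j) (y j)\<bar> < \<epsilon>" by (auto simp: eventually_sequentially)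
  with large[of j] show False by (simp add: g_def y_def)
qed

lemma uniformly_null_on_range_tendsto:
  assumes "uniformly_null_on (range x) f"
  shows "(\<lambda>n. blinfun_apply (f n) (x n)) \<longlonglongrightarrow> 0"
proof (rule LIMSEQ_I)
  fix e :: real assume "e > 0"
  with assms have "\<forall>\<^sub>F n in sequentially. \<forall>z\<in>range x. dist (blinfun_apply (f n) z) 0 < e"
    unfolding uniformly_null_on_def uniform_limit_iff by blast
  then show "\<exists>N. \<forall>n\<ge>N. norm (blinfun_apply (f n) (x n) - 0) < e"
    by (auto simp: eventually_sequentially)
qed

theorem theorem2p2:
  fixes p :: real
  assumes "p \<ge> 1"
  shows
    "(disjoint_DPP p TYPE('a::banach_lattice) \<longleftrightarrow>
        (\<forall>x :: nat \<Rightarrow> 'a. disjoint_seq x \<and> weakly_summable p x \<longrightarrow>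
           almost_dunford_pettis (range x)))
     \<and> (disjoint_DPP p TYPE('a) \<longleftrightarrow>
        (\<forall>(x :: nat \<Rightarrow> 'a) (f :: nat \<Rightarrow> 'a dual).
           disjoint_seq x \<and> weakly_summable p x \<and> dual_disjoint_seq f \<and> weakly_null f \<longrightarrow>
           (\<lambda>n. blinfun_apply (f n) (x n)) \<longlonglongrightarrow> 0))
     \<and> (disjoint_DPP p TYPE('a) \<longleftrightarrow>
        (\<forall>(x :: nat \<Rightarrow> 'a) (f :: nat \<Rightarrow> 'a dual).
           disjoint_seq x \<and> weakly_summable p x \<and>
           dual_positive_seq f \<and> dual_disjoint_seq f \<and> weakly_null f \<longrightarrow>
           (\<lambda>n. blinfun_apply (f n) (x n)) \<longlonglongrightarrow> 0))
     \<and> (disjoint_DPP p TYPE('a) \<longleftrightarrow>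
        (\<forall>(x :: nat \<Rightarrow> 'a) (f :: nat \<Rightarrow> 'a dual).
           disjoint_seq x \<and> weakly_summable p x \<and> dual_positive_seq f \<and> weakly_null f \<longrightarrow>
           (\<lambda>n. blinfun_apply (f n) (x n)) \<longlonglongrightarrow> 0))"
    (is "(?A \<longleftrightarrow> ?B) \<and> (?A \<longleftrightarrow> ?C) \<and> (?A \<longleftrightarrow> ?D) \<and> (?A \<longleftrightarrow> ?E)")
proof -
  have AB: "?B" if ?A
    using that weakly_summable_imp_bounded[OF _ assms]
    unfolding disjoint_DPP_def dunford_pettis_def almost_dunford_pettis_def by blast
  have AE: "?E" if ?A
    using that uniformly_null_on_range_tendsto
    unfolding disjoint_DPP_def dunford_pettis_def by blast
  have BC: "?C" if ?B
    using that uniformly_null_on_range_tendsto unfolding almost_dunford_pettis_def by blast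
  have CD: "?D" if ?C using that by blast
  have ED: "?D" if ?E using that by blast
  have DA: "?A" if ?D
    by (rule disjoint_DPP_if_positive_disjoint) (use that in blast)
  from AB AE BC CD ED DA show ?thesis by argo
qed

end
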